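(* For every constant $K>0$ there exist constants $C_1,C_2,C_3,c>0$, depending only on $K$, such that the following holds. Let $n,m\ge 1$, $r>0$, $\sigma>0$, $\delta\in(0,1)$, let $R$ be an arbitrary probability distribution on $\mathbb{R}^n$ supported on an $\ell_2$ ball of radius $r$, and let $A\in\mathbb{R}^{m\times n}$ be an arbitrary matrix. Suppose there exists a (possibly randomized) algorithm which, for $x^*\sim R$ and $y=Ax^*+\xi$ with $\xi\sim\mathcal{N}(0,\frac{\sigma^2}{m}I_m)$ independent of $x^*$, takes $(y,A)$ as input and outputs $\widehat{x}$ with $$\|x^*-\widehat{x}\|\le K\sigma\quad\text{with probability}\ \ge 1-\delta .$$ Let $$m'\ \ge\ C_1\left(m\log\left(1+\frac{m r^2\|A\|_\infty^2}{\sigma^2}\right)+\log\frac1\delta\right)$$ be a positive integer. Let $x^*\sim R$ and let $y'$ be generated from $x^*$ by a Gaussian measurement process with $m'$ measurements and noise level $\sigma$, with Gaussian measurement matrix $A'\in\mathbb{R}^{m'\times n}$. Then posterior sampling with respect to $R$, i.e. $\widehat{x}\sim R(\cdot\mid y',A')$, satisfies $$\|x^*-\widehat{x}\|\le C_2\sigma\quad\text{with probability}\ \ge 1-C_3\delta .$$ Moreover, the same conclusion holds for posterior sampling with respect to $P$, i.e. $\widehat{x}\sim P(\cdot\mid y',A')$ (still with $x^*\sim R$), for any probability distribution $P$ on $\mathbb{R}^n$ satisfying $\mathcal{W}_p(R,P)\le c\,\sigma\,\delta^{1/p}$ for some $p\ge 1$.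
   Context: $\|\cdot\|$ is the $\ell_2$ norm. For a matrix $A$ with rows $a_i$, $\|A\|_\infty=\max_i\sum_j|A_{ij}|$ is the operator norm induced by the $\ell_\infty$ norm (maximum absolute row sum). Gaussian measurement process: $y$ is generated from $x^*\in\mathbb{R}^n$ by a Gaussian measurement process with $m$ measurements and noise level $\sigma$ if $y=Ax^*+\xi$, where $A\in\mathbb{R}^{m\times n}$ has i.i.d. entries $A_{ij}\sim\mathcal{N}(0,1/m)$ and $\xi\sim\mathcal{N}(0,\frac{\sigma^2}{m}I_m)$, with $x^*,A,\xi$ independent. Posterior sampling with respect to a distribution $P$: given $y$ and $A$, output $\widehat{x}\sim P(\cdot\mid y,A)$, where $P(\cdot\mid y,A)$ is the posterior distribution of $x$ given $y$ under the model $x\sim P$, $y=Ax+\xi$; that is, $P(dx\mid y,A)\propto \exp\left(-\frac{m\|y-Ax\|^2}{2\sigma^2}\right)P(dx)$ for $m$ measurements. Given $(y,A)$, $\widehat{x}$ is drawn independently of $x^*$. Wasserstein distance: $\mathcal{W}_p(\mu,\nu)=\inf_{\gamma\in\Pi(\mu,\nu)}\left(\mathbb{E}_{(u,v)\sim\gamma}\|u-v\|^p\right)^{1/p}$, where $\Pi(\mu,\nu)$ is the set of couplings of $\mu$ and $\nu$. Probabilities are over all the randomness (signal, measurement matrix if random, noise, and algorithm). *)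

theory Defs
  imports "HOL-Probability.Probability"
begin

text \<open>
  The constants of the theorem must not depend on the dimensions, so the dimensions are natural
  numbers rather than types: a point of \<open>\<real>\<^sup>n\<close> is an extensional function on \<open>{..<n}\<close>, and an
  \<open>m \<times> n\<close> matrix is an extensional function on \<open>{..<m} \<times> {..<n}\<close>.
\<close>

type_synonym rvec = "nat \<Rightarrow> real"
type_synonym rmat = "nat \<times> nat \<Rightarrow> real"

definition vec_space :: "nat \<Rightarrow> rvec measure" where
  "vec_space n = PiM {..<n} (\<lambda>_. borel)"

definition mat_space :: "nat \<Rightarrow> nat \<Rightarrow> rmat measure" where
  "mat_space m n = PiM ({..<m} \<times> {..<n}) (\<lambda>_. borel)"

definition l2_dist :: "nat \<Rightarrow> rvec \<Rightarrow> rvec \<Rightarrow> real" where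
  "l2_dist n u v = L2_set (\<lambda>i. u i - v i) {..<n}"

definition mat_vec :: "nat \<Rightarrow> nat \<Rightarrow> rmat \<Rightarrow> rvec \<Rightarrow> rvec" where
  "mat_vec m n A x = (\<lambda>i\<in>{..<m}. \<Sum>j<n. A (i, j) * x j)"

definition vec_add :: "nat \<Rightarrow> rvec \<Rightarrow> rvec \<Rightarrow> rvec" where
  "vec_add m u v = (\<lambda>i\<in>{..<m}. u i + v i)"

text \<open>The maximum absolute row sum; meaningful for \<open>m \<ge> 1\<close>.\<close>

definition mat_norm_inf :: "nat \<Rightarrow> nat \<Rightarrow> rmat \<Rightarrow> real" where
  "mat_norm_inf m n A = Max ((\<lambda>i. \<Sum>j<n. \<bar>A (i, j)\<bar>) ` {..<m})"

definition supported_on_ball :: "nat \<Rightarrow> real \<Rightarrow> rvec measure \<Rightarrow> bool" where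
  "supported_on_ball n r R \<longleftrightarrow>
     (\<exists>z\<in>space (vec_space n). AE x in R. l2_dist n x z \<le> r)"

text \<open>The second parameter of \<^const>\<open>normal_density\<close> is the standard deviation, not the variance.\<close>

definition noise :: "nat \<Rightarrow> real \<Rightarrow> rvec measure" where
  "noise m \<sigma> = PiM {..<m} (\<lambda>_. density lborel (normal_density 0 (\<sigma> / sqrt m)))"

definition gaussian_matrix :: "nat \<Rightarrow> nat \<Rightarrow> rmat measure" where
  "gaussian_matrix m n =
     PiM ({..<m} \<times> {..<n}) (\<lambda>_. density lborel (normal_density 0 (1 / sqrt m)))"

text \<open>
  A randomized reconstruction algorithm is a Markov kernel sending the input \<open>(y, A)\<close> to the law
  of its output; its internal randomness is thereby independent of the signal given the input.
\<close>

type_synonym algo = "rvec \<times> rmat \<Rightarrow> rvec measure"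

definition algorithms :: "nat \<Rightarrow> nat \<Rightarrow> algo set" where
  "algorithms m n =
     (vec_space m \<Otimes>\<^sub>M mat_space m n) \<rightarrow>\<^sub>M prob_algebra (vec_space n)"

definition likelihood :: "nat \<Rightarrow> nat \<Rightarrow> real \<Rightarrow> rvec \<Rightarrow> rmat \<Rightarrow> rvec \<Rightarrow> real" where
  "likelihood m n \<sigma> y A x =
     exp (- (real m * (l2_dist m y (mat_vec m n A x))\<^sup>2 / (2 * \<sigma>\<^sup>2)))"

definition posterior :: "nat \<Rightarrow> nat \<Rightarrow> real \<Rightarrow> rvec measure \<Rightarrow> algo" where
  "posterior m n \<sigma> P = (\<lambda>(y, A).
     density P (\<lambda>x. ennreal (likelihood m n \<sigma> y A x) /
                    (\<integral>\<^sup>+ x'. ennreal (likelihood m n \<sigma> y A x') \<partial>P)))"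

text \<open>The joint law of \<open>(x\<^sup>*, x\<^sub>h)\<close>, where \<open>x\<^sub>h\<close> is the output of the algorithm \<open>S\<close>
  on \<open>(A x\<^sup>* + \<xi>, A)\<close>, for a fixed matrix and for a Gaussian one.\<close>

definition recovery_law ::
  "nat \<Rightarrow> nat \<Rightarrow> real \<Rightarrow> rvec measure \<Rightarrow> rmat \<Rightarrow> algo \<Rightarrow> (rvec \<times> rvec) measure" where
  "recovery_law m n \<sigma> R A S = do {
     x \<leftarrow> R;
     \<xi> \<leftarrow> noise m \<sigma>;
     xh \<leftarrow> S (vec_add m (mat_vec m n A x) \<xi>, A);
     return (vec_space n \<Otimes>\<^sub>M vec_space n) (x, xh)
   }"

definition gaussian_recovery_law ::
  "nat \<Rightarrow> nat \<Rightarrow> real \<Rightarrow> rvec measure \<Rightarrow> algo \<Rightarrow> (rvec \<times> rvec) measure" where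
  "gaussian_recovery_law m n \<sigma> R S = do {
     A \<leftarrow> gaussian_matrix m n;
     recovery_law m n \<sigma> R A S
   }"

definition couplings ::
  "nat \<Rightarrow> rvec measure \<Rightarrow> rvec measure \<Rightarrow> (rvec \<times> rvec) measure set" where
  "couplings n \<mu> \<nu> =
     {\<gamma>. sets \<gamma> = sets (vec_space n \<Otimes>\<^sub>M vec_space n) \<and>
         distr \<gamma> (vec_space n) fst = \<mu> \<and> distr \<gamma> (vec_space n) snd = \<nu>}"

definition ennreal_root :: "real \<Rightarrow> ennreal \<Rightarrow> ennreal" where
  "ennreal_root p a = (if a = \<infinity> then \<infinity> else ennreal (enn2real a powr (1 / p)))"

text \<open>The value is infinite if no coupling has a finite \<open>p\<close>-th moment.\<close>

definition wasserstein :: "nat \<Rightarrow> real \<Rightarrow> rvec measure \<Rightarrow> rvec measure \<Rightarrow> ennreal" where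
  "wasserstein n p \<mu> \<nu> =
     (INF \<gamma>\<in>couplings n \<mu> \<nu>.
        ennreal_root p (\<integral>\<^sup>+ (u, v). ennreal (l2_dist n u v powr p) \<partial>\<gamma>))"

end

theory Submission
  imports Defs
begin

text \<open>
  Running the given algorithm on a reference observation \<open>y \<sim> Q\<close>, where \<open>Q\<close> is Gaussian and
  independent of the signal, yields an output law \<open>\<nu>\<close>. The density of the law of \<open>A x + \<xi>\<close> with
  respect to \<open>Q\<close> has second moment at most \<open>(1 + m r\<^sup>2\<parallel>A\<parallel>\<^sup>2 / \<sigma>\<^sup>2)\<^bsup>2m\<^esup>\<close>, so Cauchy-Schwarz shows that \<open>\<nu>\<close> charges the
  \<open>K \<sigma>\<close>-ball around all but a \<open>2\<delta>\<close>-fraction of the signals \<open>x\<close> with mass at least a number \<open>\<kappa>\<close> for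
  which \<open>log (1 / \<kappa>)\<close> is of order \<open>m log (1 + m r\<^sup>2\<parallel>A\<parallel>\<^sup>2 / \<sigma>\<^sup>2)\<close>. By Fubini, and a coupling of \<open>R\<close>
  with \<open>P\<close>, all but a \<open>4\<delta>\<close>-fraction of the signals have \<open>P\<close>-mass at least \<open>\<kappa> \<delta>\<close> within \<open>O(\<sigma>)\<close>.

  For such a signal \<open>u\<close>, exponential moments of the misfit \<open>m' \<parallel>y' - A' x\<parallel>\<^sup>2 / (2 \<sigma>\<^sup>2)\<close> bound the
  posterior normalisation from below by \<open>exp (- O(m')) \<kappa> \<delta>\<close>, while the expected unnormalised
  posterior mass at distance at least \<open>C \<sigma>\<close> from \<open>u\<close> is at most \<open>(2 + C\<^sup>2)\<^bsup>-m'/2\<^esup>\<close>.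
\<close>

section \<open>Exponential moments of Gaussian quadratic forms\<close>

text \<open>The law of \<open>A x + \<xi>\<close> moves with the signal, and with it the output of
  the algorithm, whereas a statement about prior mass needs one measure that serves all signals at
  once. Comparing every observation law with a single \<open>Q\<close> provides it. The cost is a
  power \<open>2 * m\<close> of a quantity in which the dimension \<open>n\<close> does not appear
  by itself, and this is the logarithmic term in the bound on \<open>m'\<close>. Mass under
  \<open>\<nu>\<close> says nothing yet about mass under \<open>P\<close>, the only mass the
  posterior sees. The conversion by Fubini costs the extra factor \<open>\<delta>\<close> in
  \<open>\<kappa> * \<delta>\<close>, paid for by the term \<open>ln (1 / \<delta>)\<close>. For a
  fixed pair of points the residual is exactly Gaussian, so all moments are closed formulas, and
  candidates are combined by averaging over \<open>P\<close>. This takes the place of union bounds,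
  nets and uniform control of the random matrix. Two exponential rates compete: the loss
  \<open>exp (b * m')\<close> in the normalisation, with \<open>b\<close> determined by
  \<open>K\<close>, and the decay of the far mass. Since \<open>C\<close> is chosen after
  \<open>b\<close>, as an exponential of it, the decay wins.\<close>

lemma nn_integral_normal_density:
  assumes "\<tau> > 0"
  shows "(\<integral>\<^sup>+x. ennreal (normal_density \<mu> \<tau> x) \<partial>lborel) = 1"
  using assms by (simp add: nn_integral_eq_integral normal_density_nonneg)

text \<open>Completing the square: integrand times density is a multiple of the Gaussian density
  with mean \<open>\<mu>\<close> and deviation \<open>\<tau> / sqrt q\<close>. Positivity is asked
  of \<open>q\<close>, not of \<open>c\<close>, because negative \<open>c\<close> gives the growing
  exponentials that control the normalisation.\<close>

lemma nn_integral_exp_quadratic_normal: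
  fixes b c w \<tau> :: real
  defines "q \<equiv> 1 + 2 * c * w\<^sup>2 * \<tau>\<^sup>2"
  assumes \<tau>: "\<tau> > 0" and q: "q > 0"
  shows "(\<integral>\<^sup>+t. ennreal (exp (- c * (b + w * t)\<^sup>2)) \<partial>density lborel (normal_density 0 \<tau>)) =
    ennreal (exp (- c * b\<^sup>2 / q) / sqrt q)"
proof -
  define \<mu> where "\<mu> = - 2 * c * b * w * \<tau>\<^sup>2 / q"
  have expo: "- (t\<^sup>2) / (2 * \<tau>\<^sup>2) - c * (b + w * t)\<^sup>2 = - c * b\<^sup>2 / q - (t - \<mu>)\<^sup>2 / (2 * (\<tau> / sqrt q)\<^sup>2)"
    for t
  proof -
    have "(\<tau> / sqrt q)\<^sup>2 = \<tau>\<^sup>2 / q"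
      using q by (simp add: power_divide)
    then have "- c * b\<^sup>2 / q - (t - \<mu>)\<^sup>2 / (2 * (\<tau> / sqrt q)\<^sup>2)
        = - c * b\<^sup>2 / q - q * (t - \<mu>)\<^sup>2 / (2 * \<tau>\<^sup>2)"
      by simp
    also have "\<dots> = (- 2 * c * b\<^sup>2 * \<tau>\<^sup>2 - (q * t + 2 * c * b * w * \<tau>\<^sup>2)\<^sup>2) / (2 * \<tau>\<^sup>2 * q)"
    proof -
      have "t - \<mu> = (q * t + 2 * c * b * w * \<tau>\<^sup>2) / q"
        using q by (simp add: \<mu>_def field_simps)
      moreover have "- c * b\<^sup>2 / q - q * (X / q)\<^sup>2 / (2 * \<tau>\<^sup>2)
          = (- 2 * c * b\<^sup>2 * \<tau>\<^sup>2 - X\<^sup>2) / (2 * \<tau>\<^sup>2 * q)" for X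
        using q \<tau> by (simp add: field_simps power2_eq_square)
      ultimately show ?thesis by simp
    qed
    also have "- 2 * c * b\<^sup>2 * \<tau>\<^sup>2 - (q * t + 2 * c * b * w * \<tau>\<^sup>2)\<^sup>2
        = q * (- (t\<^sup>2) - 2 * \<tau>\<^sup>2 * c * (b + w * t)\<^sup>2)"
      unfolding q_def by algebra
    also have "q * (- (t\<^sup>2) - 2 * \<tau>\<^sup>2 * c * (b + w * t)\<^sup>2) / (2 * \<tau>\<^sup>2 * q)
        = - (t\<^sup>2) / (2 * \<tau>\<^sup>2) - c * (b + w * t)\<^sup>2"
      using q \<tau> by (simp add: field_simps)
    finally show ?thesis by simp
  qed
  have dens: "normal_density 0 \<tau> t * exp (- c * (b + w * t)\<^sup>2)
      = exp (- c * b\<^sup>2 / q) / sqrt q * normal_density \<mu> (\<tau> / sqrt q) t" for t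
  proof -
    have "sqrt (2 * pi * (\<tau> / sqrt q)\<^sup>2) = sqrt (2 * pi * \<tau>\<^sup>2) / sqrt q"
      using q by (simp add: power_divide real_sqrt_divide)
    moreover have "exp (- (t\<^sup>2) / (2 * \<tau>\<^sup>2)) * exp (- c * (b + w * t)\<^sup>2)
        = exp (- c * b\<^sup>2 / q) * exp (- (t - \<mu>)\<^sup>2 / (2 * (\<tau> / sqrt q)\<^sup>2))"
      using expo[of t] by (simp add: exp_add[symmetric])
    ultimately show ?thesis
      using q unfolding normal_density_def by simp
  qed
  have "(\<integral>\<^sup>+t. ennreal (exp (- c * (b + w * t)\<^sup>2)) \<partial>density lborel (normal_density 0 \<tau>))
      = (\<integral>\<^sup>+t. ennreal (normal_density 0 \<tau> t * exp (- c * (b + w * t)\<^sup>2)) \<partial>lborel)"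
    by (simp add: nn_integral_density ennreal_mult')
  also have "\<dots> = (\<integral>\<^sup>+t. ennreal (exp (- c * b\<^sup>2 / q) / sqrt q) *
      ennreal (normal_density \<mu> (\<tau> / sqrt q) t) \<partial>lborel)"
    unfolding dens by (intro nn_integral_cong ennreal_mult') (use q in simp)
  also have "\<dots> = ennreal (exp (- c * b\<^sup>2 / q) / sqrt q)"
    using q \<tau> by (simp add: nn_integral_cmult nn_integral_normal_density)
  finally show ?thesis .
qed

lemma one_plus_mult_pos_mono:
  fixes k s t :: real
  assumes "1 + k * t > 0" "0 \<le> s" "s \<le> t"
  shows "1 + k * s > 0"
proof (cases "k \<ge> 0")
  case True
  then show ?thesis using assms by (simp add: add_pos_nonneg)
next
  case False
  then have "k * t \<le> k * s" using assms by (intro mult_left_mono_neg) auto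
  then show ?thesis using assms by linarith
qed

text \<open>Matrix entries are integrated out one at a time, so the induction runs over an arbitrary
  finite set of positions. The entry \<open>(i0, j0)\<close> merely shifts the offset of row
  \<open>i0\<close>, which is why \<open>b\<close> is generalised and \<open>q\<close> is tracked
  row by row.\<close>

lemma nn_integral_exp_quadratic_normal_PiM:
  fixes c \<tau> :: real and w :: "nat \<Rightarrow> real" and b :: "nat \<Rightarrow> real" and T :: "(nat \<times> nat) set"
  defines "q \<equiv> \<lambda>T i. 1 + 2 * c * \<tau>\<^sup>2 * (\<Sum>e\<in>T. if fst e = i then (w (snd e))\<^sup>2 else 0)"
  assumes "finite T" "finite I" "fst ` T \<subseteq> I" "\<tau> > 0" "\<And>i. i \<in> I \<Longrightarrow> q T i > 0"
  shows "(\<integral>\<^sup>+A. ennreal (\<Prod>i\<in>I. exp (- c * (b i + (\<Sum>e\<in>T. if fst e = i then A e * w (snd e) else 0))\<^sup>2))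
      \<partial>PiM T (\<lambda>_. density lborel (normal_density 0 \<tau>))) =
    ennreal (\<Prod>i\<in>I. exp (- c * (b i)\<^sup>2 / q T i) / sqrt (q T i))"
  using assms(2,4,6)
proof (induction T arbitrary: b rule: finite_induct)
  case empty
  then show ?case by (simp add: q_def space_PiM)
next
  case (insert e T)
  let ?N = "density lborel (normal_density 0 \<tau>)"
  interpret product_sigma_finite "\<lambda>_. ?N"
    by (rule product_sigma_finite.intro)
       (rule prob_space_imp_sigma_finite[OF prob_space_normal_density[OF \<open>\<tau> > 0\<close>]])
  obtain i0 j0 where e: "e = (i0, j0)" by (cases e)
  have i0: "i0 \<in> I" using insert.prems e by auto
  \<comment> \<open>For negative \<open>c\<close> the factor \<open>q\<close> shrinks as positions
    are added, so positivity passes down from the larger set.\<close>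
  have qT: "q T i > 0" if "i \<in> I" for i
    unfolding q_def
    by (rule one_plus_mult_pos_mono[OF insert.prems(2)[OF that, unfolded q_def]])
       (auto simp: sum_nonneg insert intro!: sum_mono2)
  have q_ins: "q (insert e T) i = q T i + (if i = i0 then 2 * c * \<tau>\<^sup>2 * (w j0)\<^sup>2 else 0)" for i
    using insert by (simp add: q_def e algebra_simps)
  let ?l = "\<lambda>T A i. \<Sum>e\<in>T. if fst e = i then A e * w (snd e) else (0::real)"
  let ?f = "\<lambda>A. ennreal (\<Prod>i\<in>I. exp (- c * (b i + ?l (insert e T) A i)\<^sup>2))"
  have upd: "?l (insert e T) (A(e := t)) i = (if i = i0 then w j0 * t else 0) + ?l T A i" for A t i
  proof -
    have "?l T (A(e := t)) i = ?l T A i"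
      using insert by (intro sum.cong) auto
    then show ?thesis
      using insert by (simp add: e mult.commute)
  qed
  have meas: "?f \<in> borel_measurable (PiM (insert e T) (\<lambda>_. ?N))"
    by measurable
  have "integral\<^sup>N (PiM (insert e T) (\<lambda>_. ?N)) ?f
      = (\<integral>\<^sup>+t. (\<integral>\<^sup>+A. ?f (A(e := t)) \<partial>PiM T (\<lambda>_. ?N)) \<partial>?N)"
    by (rule product_nn_integral_insert_rev[OF insert(1,2) meas])
  also have "\<dots> = (\<integral>\<^sup>+t. ennreal (\<Prod>i\<in>I. exp (- c * ((b(i0 := b i0 + w j0 * t)) i)\<^sup>2 / q T i) / sqrt (q T i)) \<partial>?N)"
  proof (rule nn_integral_cong)
    fix t
    have "(\<integral>\<^sup>+A. ?f (A(e := t)) \<partial>PiM T (\<lambda>_. ?N))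
       = (\<integral>\<^sup>+A. ennreal (\<Prod>i\<in>I. exp (- c * ((b(i0 := b i0 + w j0 * t)) i + ?l T A i)\<^sup>2)) \<partial>PiM T (\<lambda>_. ?N))"
      unfolding upd by (intro nn_integral_cong arg_cong[where f=ennreal] prod.cong) (auto simp: algebra_simps)
    also have "\<dots> = ennreal (\<Prod>i\<in>I. exp (- c * ((b(i0 := b i0 + w j0 * t)) i)\<^sup>2 / q T i) / sqrt (q T i))"
      by (rule insert.IH) (use insert.prems qT in auto)
    finally show "(\<integral>\<^sup>+A. ?f (A(e := t)) \<partial>PiM T (\<lambda>_. ?N)) = \<dots>" .
  qed
  \<comment> \<open>The variable \<open>t\<close> occurs in row \<open>i0\<close> alone, with rate
    \<open>c / q T i0\<close>; integrating it turns the factor \<open>q T i0\<close> of that row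
    into \<open>q (insert e T) i0\<close>.\<close>
  also have "\<dots> = (\<integral>\<^sup>+t. ennreal ((\<Prod>i\<in>I-{i0}. exp (- c * (b i)\<^sup>2 / q T i) / sqrt (q T i)) / sqrt (q T i0))
      * ennreal (exp (- (c / q T i0) * (b i0 + w j0 * t)\<^sup>2)) \<partial>?N)"
  proof (rule nn_integral_cong)
    fix t
    have "(\<Prod>i\<in>I. exp (- c * ((b(i0 := b i0 + w j0 * t)) i)\<^sup>2 / q T i) / sqrt (q T i))
      = (exp (- c * (b i0 + w j0 * t)\<^sup>2 / q T i0) / sqrt (q T i0))
        * (\<Prod>i\<in>I-{i0}. exp (- c * (b i)\<^sup>2 / q T i) / sqrt (q T i))"
      using i0 \<open>finite I\<close> by (subst prod.remove[of _ i0]) auto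
    also have "\<dots> = ((\<Prod>i\<in>I-{i0}. exp (- c * (b i)\<^sup>2 / q T i) / sqrt (q T i)) / sqrt (q T i0))
      * exp (- (c / q T i0) * (b i0 + w j0 * t)\<^sup>2)"
      by simp
    finally have eq: "(\<Prod>i\<in>I. exp (- c * ((b(i0 := b i0 + w j0 * t)) i)\<^sup>2 / q T i) / sqrt (q T i)) = \<dots>" .
    show "ennreal (\<Prod>i\<in>I. exp (- c * ((b(i0 := b i0 + w j0 * t)) i)\<^sup>2 / q T i) / sqrt (q T i)) =
      ennreal ((\<Prod>i\<in>I-{i0}. exp (- c * (b i)\<^sup>2 / q T i) / sqrt (q T i)) / sqrt (q T i0))
      * ennreal (exp (- (c / q T i0) * (b i0 + w j0 * t)\<^sup>2))"
      unfolding eq by (rule ennreal_mult'') simp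
  qed
  also have "\<dots> = ennreal ((\<Prod>i\<in>I-{i0}. exp (- c * (b i)\<^sup>2 / q T i) / sqrt (q T i)) / sqrt (q T i0))
      * (\<integral>\<^sup>+t. ennreal (exp (- (c / q T i0) * (b i0 + w j0 * t)\<^sup>2)) \<partial>?N)"
    by (rule nn_integral_cmult) measurable
  also have "(\<integral>\<^sup>+t. ennreal (exp (- (c / q T i0) * (b i0 + w j0 * t)\<^sup>2)) \<partial>?N)
      = ennreal (exp (- c * (b i0)\<^sup>2 / q (insert e T) i0) / sqrt (q (insert e T) i0 / q T i0))"
  proof -
    have *: "1 + 2 * (c / q T i0) * (w j0)\<^sup>2 * \<tau>\<^sup>2 = q (insert e T) i0 / q T i0"
      using qT[OF i0] by (simp add: q_ins field_simps)
    show ?thesis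
      using nn_integral_exp_quadratic_normal[of \<tau> "c / q T i0" "w j0" "b i0"] qT[OF i0]
        insert.prems(2)[OF i0] \<open>\<tau> > 0\<close> unfolding * by simp
  qed
  also have "ennreal ((\<Prod>i\<in>I-{i0}. exp (- c * (b i)\<^sup>2 / q T i) / sqrt (q T i)) / sqrt (q T i0)) *
      ennreal (exp (- c * (b i0)\<^sup>2 / q (insert e T) i0) / sqrt (q (insert e T) i0 / q T i0))
     = ennreal ((exp (- c * (b i0)\<^sup>2 / q (insert e T) i0) / sqrt (q (insert e T) i0)) *
        (\<Prod>i\<in>I-{i0}. exp (- c * (b i)\<^sup>2 / q T i) / sqrt (q T i)))"
    (is "ennreal ?a * ennreal ?b = ennreal ?c")
  proof -
    have "?a * ?b = ?c"
      using qT[OF i0] by (simp add: real_sqrt_divide)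
    moreover have "ennreal (?a * ?b) = ennreal ?a * ennreal ?b"
      using qT[OF i0] insert.prems(2)[OF i0] by (intro ennreal_mult'') simp
    ultimately show ?thesis by simp
  qed
  also have "(\<Prod>i\<in>I-{i0}. exp (- c * (b i)\<^sup>2 / q T i) / sqrt (q T i))
     = (\<Prod>i\<in>I-{i0}. exp (- c * (b i)\<^sup>2 / q (insert e T) i) / sqrt (q (insert e T) i))"
    by (intro prod.cong) (auto simp: q_ins)
  also have "(exp (- c * (b i0)\<^sup>2 / q (insert e T) i0) / sqrt (q (insert e T) i0)) *
        (\<Prod>i\<in>I-{i0}. exp (- c * (b i)\<^sup>2 / q (insert e T) i) / sqrt (q (insert e T) i))
     = (\<Prod>i\<in>I. exp (- c * (b i)\<^sup>2 / q (insert e T) i) / sqrt (q (insert e T) i))"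
    using i0 \<open>finite I\<close> by (subst (2) prod.remove[of _ i0]) auto
  finally show ?case .
qed

section \<open>The misfit of a candidate signal and its exponential moments\<close>

definition misfit :: "nat \<Rightarrow> nat \<Rightarrow> real \<Rightarrow> rvec \<Rightarrow> rmat \<Rightarrow> rvec \<Rightarrow> real" where
  "misfit m n \<sigma> y A x = real m * (l2_dist m y (mat_vec m n A x))\<^sup>2 / (2 * \<sigma>\<^sup>2)"

lemma likelihood_misfit: "likelihood m n \<sigma> y A x = exp (- misfit m n \<sigma> y A x)"
  by (simp add: likelihood_def misfit_def)

lemma l2_dist_square: "(l2_dist n u v)\<^sup>2 = (\<Sum>i<n. (u i - v i)\<^sup>2)"
  by (simp add: l2_dist_def L2_set_def sum_nonneg)

lemma sum_Times_if_fst: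
  fixes f :: "nat \<times> 'a \<Rightarrow> real"
  assumes "i < m"
  shows "(\<Sum>e\<in>{..<m} \<times> J. if fst e = i then f e else 0) = (\<Sum>j\<in>J. f (i, j))"
proof -
  have "(\<Sum>e\<in>{..<m} \<times> J. if fst e = i then f e else 0) =
      (\<Sum>i'<m. if i' = i then (\<Sum>j\<in>J. f (i', j)) else 0)"
    unfolding sum.cartesian_product' by (intro sum.cong) auto
  also have "\<dots> = (\<Sum>j\<in>J. f (i, j))"
    using assms by simp
  finally show ?thesis .
qed

text \<open>With \<open>y = A u + \<xi>\<close> the residual is \<open>\<xi> + A (u - x)\<close>, so
  only the difference of the two signals enters. The sum over all matrix positions is the form the
  product integral above expects.\<close>

lemma misfit_eq:
  "misfit m n \<sigma> (vec_add m (mat_vec m n A u) \<xi>) A x =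
    (\<Sum>i<m. real m / (2 * \<sigma>\<^sup>2) *
      (\<xi> i + (\<Sum>e\<in>{..<m} \<times> {..<n}. if fst e = i then A e * (u (snd e) - x (snd e)) else 0))\<^sup>2)"
  unfolding misfit_def l2_dist_square sum_distrib_left sum_divide_distrib
  by (intro sum.cong)
     (auto simp: vec_add_def mat_vec_def sum_Times_if_fst algebra_simps sum_subtractf)

text \<open>The coordinates of \<open>\<xi> + A (u - x)\<close> are independent centred Gaussians of
  variance \<open>(d\<^sup>2 + \<sigma>\<^sup>2) / m\<close>, so this is the Laplace transform of a
  scaled chi-square variable with \<open>m\<close> degrees of freedom. It is exact for
  \<open>k\<close> of either sign while the base stays positive.\<close>

lemma nn_integral_exp_misfit:
  fixes n m :: nat and k \<sigma> :: real and u x :: rvec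
  defines "d \<equiv> l2_dist n u x"
  assumes m: "m \<ge> 1" and \<sigma>: "\<sigma> > 0" and pos: "1 + k * (d\<^sup>2 + \<sigma>\<^sup>2) / \<sigma>\<^sup>2 > 0"
  shows "(\<integral>\<^sup>+\<xi>. (\<integral>\<^sup>+A. ennreal (exp (- k * misfit m n \<sigma> (vec_add m (mat_vec m n A u) \<xi>) A x))
      \<partial>gaussian_matrix m n) \<partial>noise m \<sigma>) =
    ennreal ((1 / sqrt (1 + k * (d\<^sup>2 + \<sigma>\<^sup>2) / \<sigma>\<^sup>2)) ^ m)"
proof -
  define c where "c = k * real m / (2 * \<sigma>\<^sup>2)"
  define q where "q = 1 + k * d\<^sup>2 / \<sigma>\<^sup>2"
  define Q where "Q = 1 + k * (d\<^sup>2 + \<sigma>\<^sup>2) / \<sigma>\<^sup>2"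
  have q: "q > 0"
  proof -
    have "1 + k / \<sigma>\<^sup>2 * d\<^sup>2 > 0"
      by (rule one_plus_mult_pos_mono[where t="d\<^sup>2 + \<sigma>\<^sup>2"]) (use pos in auto)
    then show ?thesis by (simp add: q_def)
  qed
  have qsum: "1 + 2 * c * (1 / sqrt (real m))\<^sup>2 *
     (\<Sum>e\<in>{..<m} \<times> {..<n}. if fst e = i then (u (snd e) - x (snd e))\<^sup>2 else 0) = q" if "i < m" for i
    using that m by (simp add: sum_Times_if_fst q_def c_def power_divide d_def l2_dist_square)
  have ex: "exp (- k * misfit m n \<sigma> (vec_add m (mat_vec m n A u) \<xi>) A x) = (\<Prod>i<m. exp (- c * (\<xi> i +
      (\<Sum>e\<in>{..<m} \<times> {..<n}. if fst e = i then A e * (u (snd e) - x (snd e)) else 0))\<^sup>2))" for \<xi> A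
    by (simp add: misfit_eq exp_sum[symmetric] sum_distrib_left c_def mult.assoc sum_negf)
  have inner: "(\<integral>\<^sup>+A. ennreal (exp (- k * misfit m n \<sigma> (vec_add m (mat_vec m n A u) \<xi>) A x)) \<partial>gaussian_matrix m n)
     = (\<Prod>i<m. ennreal (1 / sqrt q) * ennreal (exp (- (c / q) * (0 + 1 * \<xi> i)\<^sup>2)))" for \<xi>
  proof -
    have "(\<integral>\<^sup>+A. ennreal (exp (- k * misfit m n \<sigma> (vec_add m (mat_vec m n A u) \<xi>) A x)) \<partial>gaussian_matrix m n)
      = ennreal (\<Prod>i<m. exp (- c * (\<xi> i)\<^sup>2 / q) / sqrt q)"
      unfolding ex gaussian_matrix_def
      by (subst nn_integral_exp_quadratic_normal_PiM[where w="\<lambda>j. u j - x j"])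
         (use m q in \<open>auto simp: qsum intro!: arg_cong[where f=ennreal] prod.cong\<close>)
    also have "\<dots> = (\<Prod>i<m. ennreal (exp (- c * (\<xi> i)\<^sup>2 / q) / sqrt q))"
      by (rule prod_ennreal[symmetric]) (use q in auto)
    finally show ?thesis using q by (simp add: ennreal_mult'[symmetric])
  qed
  let ?N = "density lborel (normal_density 0 (\<sigma> / sqrt (real m)))"
  interpret product_sigma_finite "\<lambda>_::nat. ?N"
    by (rule product_sigma_finite.intro)
       (rule prob_space_imp_sigma_finite[OF prob_space_normal_density], use m \<sigma> in auto)
  \<comment> \<open>Averaging over the matrix leaves each noise coordinate with rate
    \<open>c / q\<close>. As \<open>Q = q + k\<close>, the factors \<open>sqrt q\<close> and
    \<open>sqrt (Q / q)\<close> combine to \<open>sqrt Q\<close>.\<close>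
  have Qq: "1 + 2 * (c / q) * 1\<^sup>2 * (\<sigma> / sqrt (real m))\<^sup>2 = Q / q"
  proof -
    have "2 * c * (\<sigma> / sqrt (real m))\<^sup>2 = k"
      using m \<sigma> by (simp add: c_def power_divide)
    moreover have "Q = q + k"
      using \<sigma> by (simp add: Q_def q_def field_simps)
    ultimately show ?thesis
      using q by (simp add: field_simps)
  qed
  have "(\<integral>\<^sup>+\<xi>. (\<integral>\<^sup>+A. ennreal (exp (- k * misfit m n \<sigma> (vec_add m (mat_vec m n A u) \<xi>) A x))
      \<partial>gaussian_matrix m n) \<partial>noise m \<sigma>)
     = (\<Prod>i<m. \<integral>\<^sup>+t. ennreal (1 / sqrt q) * ennreal (exp (- (c / q) * (0 + 1 * t)\<^sup>2)) \<partial>?N)"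
    unfolding inner noise_def by (rule product_nn_integral_prod) auto
  also have "(\<integral>\<^sup>+t. ennreal (1 / sqrt q) * ennreal (exp (- (c / q) * (0 + 1 * t)\<^sup>2)) \<partial>?N)
     = ennreal (1 / sqrt q) * (\<integral>\<^sup>+t. ennreal (exp (- (c / q) * (0 + 1 * t)\<^sup>2)) \<partial>?N)"
    by (rule nn_integral_cmult) measurable
  also have "(\<integral>\<^sup>+t. ennreal (exp (- (c / q) * (0 + 1 * t)\<^sup>2)) \<partial>?N) = ennreal (1 / sqrt (Q / q))"
    using nn_integral_exp_quadratic_normal[of "\<sigma> / sqrt (real m)" "c / q" 1 0] pos q m \<sigma>
    unfolding Qq Q_def[symmetric] by simp
  also have "ennreal (1 / sqrt q) * ennreal (1 / sqrt (Q / q)) = ennreal (1 / sqrt Q)"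
    using q by (simp add: ennreal_mult'[symmetric] real_sqrt_divide)
  finally show ?thesis
    using pos by (simp add: Q_def[symmetric] ennreal_power)
qed

section \<open>Measurability and the recovery laws\<close>

lemma measurable_vec_component:
  assumes "f \<in> M \<rightarrow>\<^sub>M vec_space n" "i < n"
  shows "(\<lambda>p. f p i) \<in> borel_measurable M"
  using measurable_compose[OF assms(1)[unfolded vec_space_def] measurable_component_singleton[of i]] assms(2)
  by simp

lemma measurable_l2_dist [measurable (raw)]:
  assumes "f \<in> M \<rightarrow>\<^sub>M vec_space n" "g \<in> M \<rightarrow>\<^sub>M vec_space n"
  shows "(\<lambda>p. l2_dist n (f p) (g p)) \<in> borel_measurable M"
  unfolding l2_dist_def L2_set_def
  by (intro measurable_compose[OF _ borel_measurable_sqrt] borel_measurable_sum borel_measurable_power borel_measurable_diff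
      measurable_vec_component[OF assms(1)] measurable_vec_component[OF assms(2)]) auto

lemma measurable_mat_vec [measurable (raw)]:
  assumes "f \<in> M \<rightarrow>\<^sub>M mat_space m n" "g \<in> M \<rightarrow>\<^sub>M vec_space n"
  shows "(\<lambda>p. mat_vec m n (f p) (g p)) \<in> M \<rightarrow>\<^sub>M vec_space m"
proof -
  have "(\<lambda>p. f p (i, j)) \<in> borel_measurable M" if "i < m" "j < n" for i j
    using measurable_compose[OF assms(1)[unfolded mat_space_def] measurable_component_singleton[of "(i, j)"]] that
    by simp
  then show ?thesis
    unfolding mat_vec_def vec_space_def
    by (intro measurable_restrict borel_measurable_sum borel_measurable_times
        measurable_vec_component[OF assms(2)]) auto
qed

lemma measurable_vec_add [measurable (raw)]:
  assumes "f \<in> M \<rightarrow>\<^sub>M vec_space m" "g \<in> M \<rightarrow>\<^sub>M vec_space m"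
  shows "(\<lambda>p. vec_add m (f p) (g p)) \<in> M \<rightarrow>\<^sub>M vec_space m"
  unfolding vec_add_def vec_space_def
  by (intro measurable_restrict borel_measurable_add measurable_vec_component[OF assms(1)]
      measurable_vec_component[OF assms(2)]) auto

lemma measurable_misfit [measurable (raw)]:
  assumes [measurable]: "f \<in> M \<rightarrow>\<^sub>M vec_space m" "g \<in> M \<rightarrow>\<^sub>M mat_space m n" "h \<in> M \<rightarrow>\<^sub>M vec_space n"
  shows "(\<lambda>p. misfit m n \<sigma> (f p) (g p) (h p)) \<in> borel_measurable M"
  unfolding misfit_def by measurable

lemma measurable_likelihood [measurable (raw)]:
  assumes [measurable]: "f \<in> M \<rightarrow>\<^sub>M vec_space m" "g \<in> M \<rightarrow>\<^sub>M mat_space m n" "h \<in> M \<rightarrow>\<^sub>M vec_space n"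
  shows "(\<lambda>p. likelihood m n \<sigma> (f p) (g p) (h p)) \<in> borel_measurable M"
  unfolding likelihood_misfit by measurable

lemma prob_space_PiM_normal:
  assumes "finite I" "\<And>i. i \<in> I \<Longrightarrow> \<tau> i > 0"
  shows "prob_space (PiM I (\<lambda>i. density lborel (normal_density (\<mu> i) (\<tau> i))))"
  by (intro prob_space_PiM prob_space_normal_density assms)

lemma noise_in_prob_algebra:
  assumes "m \<ge> 1" "\<sigma> > 0"
  shows "noise m \<sigma> \<in> space (prob_algebra (vec_space m))"
  using assms unfolding noise_def vec_space_def
  by (auto simp: space_prob_algebra intro!: sets_PiM_cong prob_space_PiM_normal)

lemma gaussian_matrix_in_prob_algebra:
  assumes "m \<ge> 1"
  shows "gaussian_matrix m n \<in> space (prob_algebra (mat_space m n))"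
  using assms unfolding gaussian_matrix_def mat_space_def
  by (auto simp: space_prob_algebra intro!: sets_PiM_cong prob_space_PiM_normal)

lemma recovery_law_measurable:
  assumes "m \<ge> 1" "\<sigma> > 0" and R: "R \<in> space (prob_algebra (vec_space n))" and "S \<in> algorithms m n"
  shows "(\<lambda>A. recovery_law m n \<sigma> R A S) \<in> mat_space m n \<rightarrow>\<^sub>M prob_algebra (vec_space n \<Otimes>\<^sub>M vec_space n)"
proof -
  have [measurable]: "S \<in> vec_space m \<Otimes>\<^sub>M mat_space m n \<rightarrow>\<^sub>M prob_algebra (vec_space n)"
    using assms by (simp add: algorithms_def)
  note [measurable] = measurable_const[OF R] measurable_const[OF noise_in_prob_algebra[OF assms(1,2)]]
  show ?thesis
    unfolding recovery_law_def by measurable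
qed

lemma emeasure_recovery_law:
  assumes "m \<ge> 1" "\<sigma> > 0" and R: "R \<in> space (prob_algebra (vec_space n))" and "S \<in> algorithms m n"
    and [measurable]: "A \<in> space (mat_space m n)"
    and [measurable]: "Measurable.pred (vec_space n \<Otimes>\<^sub>M vec_space n) (\<lambda>(x, xh). Q x xh)"
  shows "emeasure (recovery_law m n \<sigma> R A S) {p \<in> space (vec_space n \<Otimes>\<^sub>M vec_space n). case p of (x, xh) \<Rightarrow> Q x xh}
    = (\<integral>\<^sup>+x. (\<integral>\<^sup>+\<xi>. emeasure (S (vec_add m (mat_vec m n A x) \<xi>, A)) {xh \<in> space (vec_space n). Q x xh}
        \<partial>noise m \<sigma>) \<partial>R)"
proof -
  have S[measurable]: "S \<in> vec_space m \<Otimes>\<^sub>M mat_space m n \<rightarrow>\<^sub>M prob_algebra (vec_space n)"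
    using assms by (simp add: algorithms_def)
  note N = noise_in_prob_algebra[OF assms(1,2)]
  note [measurable] = measurable_const[OF N]
  let ?V = "vec_space n"
  let ?X = "{p \<in> space (?V \<Otimes>\<^sub>M ?V). case p of (x, xh) \<Rightarrow> Q x xh}"
  have X[measurable]: "?X \<in> sets (?V \<Otimes>\<^sub>M ?V)" by measurable
  have sR: "space R = space ?V"
    using R by (auto simp: space_prob_algebra dest: sets_eq_imp_space_eq)
  have sN: "space (noise m \<sigma>) = space (vec_space m)"
    using N by (auto simp: space_prob_algebra dest: sets_eq_imp_space_eq)
  have "emeasure (recovery_law m n \<sigma> R A S) ?X
      = (\<integral>\<^sup>+x. emeasure (noise m \<sigma> \<bind> (\<lambda>\<xi>. S (vec_add m (mat_vec m n A x) \<xi>, A) \<bind>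
          (\<lambda>xh. return (?V \<Otimes>\<^sub>M ?V) (x, xh)))) ?X \<partial>R)"
    unfolding recovery_law_def
    by (rule emeasure_bind_prob_algebra[OF R _ X]) measurable
  also have "\<dots> = (\<integral>\<^sup>+x. (\<integral>\<^sup>+\<xi>. emeasure (S (vec_add m (mat_vec m n A x) \<xi>, A)) {xh \<in> space ?V. Q x xh}
        \<partial>noise m \<sigma>) \<partial>R)"
  proof (rule nn_integral_cong)
    fix x assume "x \<in> space R"
    then have x[measurable]: "x \<in> space ?V" by (simp add: sR)
    have "emeasure (noise m \<sigma> \<bind> (\<lambda>\<xi>. S (vec_add m (mat_vec m n A x) \<xi>, A) \<bind>
          (\<lambda>xh. return (?V \<Otimes>\<^sub>M ?V) (x, xh)))) ?X
       = (\<integral>\<^sup>+\<xi>. emeasure (S (vec_add m (mat_vec m n A x) \<xi>, A) \<bind>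
          (\<lambda>xh. return (?V \<Otimes>\<^sub>M ?V) (x, xh))) ?X \<partial>noise m \<sigma>)"
      by (rule emeasure_bind_prob_algebra[OF N _ X]) measurable
    also have "\<dots> = (\<integral>\<^sup>+\<xi>. emeasure (S (vec_add m (mat_vec m n A x) \<xi>, A)) {xh \<in> space ?V. Q x xh}
        \<partial>noise m \<sigma>)"
    proof (rule nn_integral_cong)
      fix \<xi> assume "\<xi> \<in> space (noise m \<sigma>)"
      then have \<xi>[measurable]: "\<xi> \<in> space (vec_space m)" by (simp add: sN)
      let ?T = "S (vec_add m (mat_vec m n A x) \<xi>, A)"
      have T: "?T \<in> space (prob_algebra ?V)"
      proof -
        have "(\<lambda>\<xi>. S (vec_add m (mat_vec m n A x) \<xi>, A)) \<in> vec_space m \<rightarrow>\<^sub>M prob_algebra ?V"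
          by measurable
        then show ?thesis using \<xi> by (rule measurable_space)
      qed
      have sT: "sets ?T = sets ?V" "space ?T = space ?V"
        using T by (auto simp: space_prob_algebra dest: sets_eq_imp_space_eq)
      have "emeasure (?T \<bind> (\<lambda>xh. return (?V \<Otimes>\<^sub>M ?V) (x, xh))) ?X
        = (\<integral>\<^sup>+xh. emeasure (return (?V \<Otimes>\<^sub>M ?V) (x, xh)) ?X \<partial>?T)"
        by (rule emeasure_bind_prob_algebra[OF T _ X]) measurable
      also have "\<dots> = (\<integral>\<^sup>+xh. indicator {xh \<in> space ?V. Q x xh} xh \<partial>?T)"
        using x by (intro nn_integral_cong) (auto simp: sT space_pair_measure split: split_indicator)
      also have "\<dots> = emeasure ?T {xh \<in> space ?V. Q x xh}"
      proof (rule nn_integral_indicator)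
        have "{xh \<in> space ?V. Q x xh} = {xh \<in> space ?V. case (x, xh) of (x, xh) \<Rightarrow> Q x xh}" by simp
        also have "\<dots> \<in> sets ?V" by measurable
        finally show "{xh \<in> space ?V. Q x xh} \<in> sets ?T" by (simp add: sT)
      qed
      finally show "emeasure (?T \<bind> (\<lambda>xh. return (?V \<Otimes>\<^sub>M ?V) (x, xh))) ?X = emeasure ?T {xh \<in> space ?V. Q x xh}" .
    qed
    finally show "emeasure (noise m \<sigma> \<bind> (\<lambda>\<xi>. S (vec_add m (mat_vec m n A x) \<xi>, A) \<bind>
          (\<lambda>xh. return (?V \<Otimes>\<^sub>M ?V) (x, xh)))) ?X = \<dots>" .
  qed
  finally show ?thesis .
qed

text \<open>The likelihood lies in \<open>(0, 1]\<close> everywhere, so the normalisation is neither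
  zero nor infinite at any observation whatsoever. This matters because observations come from
  \<open>R\<close> while the model is \<open>P\<close>, so an exceptional set for \<open>P\<close>
  could not be discarded.\<close>

lemma evidence_pos:
  assumes P: "P \<in> space (prob_algebra (vec_space n))" and A[measurable]: "A \<in> space (mat_space m n)"
    and y[measurable]: "y \<in> space (vec_space m)"
  shows "(\<integral>\<^sup>+x. ennreal (likelihood m n \<sigma> y A x) \<partial>P) \<noteq> 0"
    and "(\<integral>\<^sup>+x. ennreal (likelihood m n \<sigma> y A x) \<partial>P) \<noteq> \<top>"
proof -
  interpret prob_space P using P by (simp add: space_prob_algebra)
  have sP[measurable_cong]: "sets P = sets (vec_space n)" using P by (simp add: space_prob_algebra)
  have "\<not> (AE x in P. ennreal (likelihood m n \<sigma> y A x) = 0)"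
    by (simp add: likelihood_def)
  then show "(\<integral>\<^sup>+x. ennreal (likelihood m n \<sigma> y A x) \<partial>P) \<noteq> 0"
    by (subst nn_integral_0_iff_AE) measurable
  have "(\<integral>\<^sup>+x. ennreal (likelihood m n \<sigma> y A x) \<partial>P) \<le> (\<integral>\<^sup>+x. 1 \<partial>P)"
    by (intro nn_integral_mono) (auto simp: likelihood_def intro!: divide_nonneg_nonneg)
  also have "\<dots> = 1" by (simp add: emeasure_space_1)
  finally show "(\<integral>\<^sup>+x. ennreal (likelihood m n \<sigma> y A x) \<partial>P) \<noteq> \<top>"
    by (auto simp: top_unique)
qed

lemma emeasure_posterior:
  assumes P: "P \<in> space (prob_algebra (vec_space n))" and A[measurable]: "A \<in> space (mat_space m n)"
    and y[measurable]: "y \<in> space (vec_space m)" and B: "B \<in> sets (vec_space n)"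
  shows "emeasure (posterior m n \<sigma> P (y, A)) B =
    (\<integral>\<^sup>+x. ennreal (likelihood m n \<sigma> y A x) * indicator B x \<partial>P) /
    (\<integral>\<^sup>+x. ennreal (likelihood m n \<sigma> y A x) \<partial>P)"
proof -
  have [measurable_cong]: "sets P = sets (vec_space n)" using P by (simp add: space_prob_algebra)
  note [measurable] = B
  show ?thesis
    unfolding posterior_def split
    by (simp add: emeasure_density nn_integral_divide[symmetric] ennreal_times_divide[symmetric] mult.commute
        ennreal_divide_times)
qed

text \<open>Allows the posterior to take the place of an algorithm in the recovery laws.
  Measurability in \<open>(y, A)\<close> comes from writing each event probability as a quotient of
  two parametrised integrals.\<close>

lemma posterior_in_algorithms:
  assumes P: "P \<in> space (prob_algebra (vec_space n))"
  shows "posterior m n \<sigma> P \<in> algorithms m n"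
proof -
  interpret P: prob_space P using P by (simp add: space_prob_algebra)
  have sP[measurable_cong]: "sets P = sets (vec_space n)" using P by (simp add: space_prob_algebra)
  have prob: "prob_space (posterior m n \<sigma> P a)"
    if "a \<in> space (vec_space m \<Otimes>\<^sub>M mat_space m n)" for a
  proof -
    obtain y A where a: "a = (y, A)" by (cases a)
    have y: "y \<in> space (vec_space m)" and A: "A \<in> space (mat_space m n)"
      using that by (auto simp: a space_pair_measure)
    have sV: "space P = space (vec_space n)" using sP by (rule sets_eq_imp_space_eq)
    have "(\<integral>\<^sup>+x. ennreal (likelihood m n \<sigma> y A x) * indicator (space (vec_space n)) x \<partial>P)
        = (\<integral>\<^sup>+x. ennreal (likelihood m n \<sigma> y A x) \<partial>P)"
      by (intro nn_integral_cong) (simp add: sV)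
    then have "emeasure (posterior m n \<sigma> P (y, A)) (space (vec_space n)) = 1"
      using evidence_pos[OF P A y, of \<sigma>] by (simp add: emeasure_posterior[OF P A y sets.top] ennreal_divide_self less_top)
    then show ?thesis
      by (intro prob_spaceI) (simp add: a posterior_def sV)
  qed
  have "posterior m n \<sigma> P \<in> vec_space m \<Otimes>\<^sub>M mat_space m n \<rightarrow>\<^sub>M subprob_algebra (vec_space n)"
  proof (rule measurable_subprob_algebra)
    fix a assume a: "a \<in> space (vec_space m \<Otimes>\<^sub>M mat_space m n)"
    show "subprob_space (posterior m n \<sigma> P a)"
      by (rule prob_space_imp_subprob_space[OF prob[OF a]])
    show "sets (posterior m n \<sigma> P a) = sets (vec_space n)"
      by (cases a) (simp add: posterior_def sP)
  next
    fix B assume B[measurable]: "B \<in> sets (vec_space n)"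
    have "(\<lambda>a. (\<integral>\<^sup>+x. ennreal (likelihood m n \<sigma> (fst a) (snd a) x) * indicator B x \<partial>P) /
        (\<integral>\<^sup>+x. ennreal (likelihood m n \<sigma> (fst a) (snd a) x) \<partial>P))
        \<in> borel_measurable (vec_space m \<Otimes>\<^sub>M mat_space m n)"
      by measurable
    then show "(\<lambda>a. emeasure (posterior m n \<sigma> P a) B) \<in> borel_measurable (vec_space m \<Otimes>\<^sub>M mat_space m n)"
      by (rule measurable_cong[THEN iffD1, rotated])
         (auto simp: space_pair_measure emeasure_posterior[OF P _ _ B])
  qed
  then show ?thesis
    unfolding algorithms_def by (intro measurable_prob_algebraI prob)
qed

section \<open>Concentration of the posterior\<close>

lemma ennreal_inverse_antimono:
  fixes a b :: ennreal
  assumes "a \<le> b"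
  shows "inverse b \<le> inverse a"
proof (cases "a = 0 \<or> b = \<top>")
  case False
  then obtain r where b: "b = ennreal r" "r \<ge> 0" by (cases b) auto
  then obtain q where a: "a = ennreal q" "q > 0"
    using False assms by (cases a) (auto simp: top_unique less_le)
  then have "q \<le> r" using assms b by simp
  with a(2) have "0 < r" "inverse r \<le> inverse q" by (auto intro: le_imp_inverse_le)
  moreover have "inverse b = ennreal (inverse r)" "inverse a = ennreal (inverse q)"
    using a \<open>0 < r\<close> by (simp_all add: b inverse_ennreal)
  ultimately show ?thesis by (simp only: ennreal_leI)
qed auto

text \<open>
  If \<open>B\<close> carries half of its mass where the misfit is at most \<open>s\<close>, the second term bounds the
  posterior mass of \<open>F\<close>; otherwise, by Markov's inequality, the first term is at least \<open>1\<close>.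
\<close>

lemma posterior_mass_le:
  fixes s \<theta> :: real
  assumes P: "P \<in> space (prob_algebra (vec_space n))" and A[measurable]: "A \<in> space (mat_space m n)"
    and y[measurable]: "y \<in> space (vec_space m)"
    and B[measurable]: "B \<in> sets (vec_space n)" and F[measurable]: "F \<in> sets (vec_space n)"
    and \<beta>: "\<beta> > 0" "emeasure P B = ennreal \<beta>" and \<theta>: "\<theta> > 0"
  shows "emeasure (posterior m n \<sigma> P (y, A)) F \<le>
    ennreal (2 / \<beta> * exp (- \<theta> * s)) * (\<integral>\<^sup>+x. ennreal (exp (\<theta> * misfit m n \<sigma> y A x)) * indicator B x \<partial>P) +
    ennreal (2 / \<beta> * exp s) * (\<integral>\<^sup>+x. ennreal (exp (- misfit m n \<sigma> y A x)) * indicator F x \<partial>P)"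
    (is "_ \<le> _ * ?I + _ * ?J")
proof -
  interpret P: prob_space P using P by (simp add: space_prob_algebra)
  have sP[measurable_cong]: "sets P = sets (vec_space n)" using P by (simp add: space_prob_algebra)
  have spP: "space P = space (vec_space n)" using sP by (rule sets_eq_imp_space_eq)
  define W where "W = (\<lambda>x. misfit m n \<sigma> y A x)"
  have [measurable]: "W \<in> borel_measurable P" unfolding W_def by measurable
  have post: "prob_space (posterior m n \<sigma> P (y, A))"
  proof -
    have "posterior m n \<sigma> P (y, A) \<in> space (prob_algebra (vec_space n))"
      by (rule measurable_space[OF posterior_in_algorithms[OF P, unfolded algorithms_def]])
         (simp add: space_pair_measure A y)
    then show ?thesis by (simp add: space_prob_algebra)
  qed
  let ?Z = "\<integral>\<^sup>+x. ennreal (exp (- W x)) \<partial>P"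
  let ?H = "{x \<in> space P. x \<in> B \<and> W x > s}" and ?L = "{x \<in> space P. x \<in> B \<and> W x \<le> s}"
  have HL: "ennreal \<beta> = emeasure P ?H + emeasure P ?L"
  proof -
    have "B = ?H \<union> ?L" using sets.sets_into_space[OF B] by (auto simp: spP)
    then have "emeasure P B = emeasure P (?H \<union> ?L)" by simp
    also have "\<dots> = emeasure P ?H + emeasure P ?L"
      by (rule plus_emeasure[symmetric]) auto
    finally show ?thesis using \<beta> by simp
  qed
  have H: "emeasure P ?H \<le> ennreal (exp (- \<theta> * s)) * ?I"
  proof -
    have "emeasure P ?H = (\<integral>\<^sup>+x. indicator ?H x \<partial>P)" by simp
    also have "\<dots> \<le> (\<integral>\<^sup>+x. ennreal (exp (- \<theta> * s)) * (ennreal (exp (\<theta> * W x)) * indicator B x) \<partial>P)"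
    proof (intro nn_integral_mono)
      fix x
      have "W x > s \<Longrightarrow> 1 \<le> exp (\<theta> * W x - \<theta> * s)" using \<theta> by simp
      then have "W x > s \<Longrightarrow> 1 \<le> exp (- \<theta> * s) * exp (\<theta> * W x)"
        by (simp add: exp_add[symmetric])
      then show "indicator ?H x \<le> ennreal (exp (- \<theta> * s)) * (ennreal (exp (\<theta> * W x)) * indicator B x)"
        by (auto split: split_indicator simp: ennreal_mult'[symmetric])
    qed
    also have "\<dots> = ennreal (exp (- \<theta> * s)) * ?I"
      unfolding W_def[symmetric] by (rule nn_integral_cmult) measurable
    finally show ?thesis .
  qed
  have Z: "ennreal (exp (- s)) * emeasure P ?L \<le> ?Z"
  proof -
    have "ennreal (exp (- s)) * emeasure P ?L = (\<integral>\<^sup>+x. ennreal (exp (- s)) * indicator ?L x \<partial>P)"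
      by (simp add: nn_integral_cmult)
    also have "\<dots> \<le> ?Z"
      by (intro nn_integral_mono) (auto split: split_indicator)
    finally show ?thesis .
  qed
  have PF: "emeasure (posterior m n \<sigma> P (y, A)) F = ?J / ?Z"
    by (simp add: emeasure_posterior[OF P A y F] likelihood_misfit W_def)
  show ?thesis
  proof (cases "emeasure P ?H \<ge> ennreal (\<beta> / 2)")
    case True
    have "emeasure (posterior m n \<sigma> P (y, A)) F \<le> 1"
      by (rule prob_space.emeasure_le_1[OF post])
    also have "1 = ennreal (2 / \<beta>) * ennreal (\<beta> / 2)"
      using \<beta> by (simp add: ennreal_mult'[symmetric])
    also have "\<dots> \<le> ennreal (2 / \<beta>) * (ennreal (exp (- \<theta> * s)) * ?I)"
      using True H by (intro mult_left_mono) auto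
    also have "\<dots> = ennreal (2 / \<beta> * exp (- \<theta> * s)) * ?I"
      using \<beta> by (subst ennreal_mult') (auto simp: mult.assoc)
    finally show ?thesis by (rule order_trans) simp
  next
    case False
    have L: "emeasure P ?L \<ge> ennreal (\<beta> / 2)"
    proof (rule ccontr)
      assume "\<not> emeasure P ?L \<ge> ennreal (\<beta> / 2)"
      then have "emeasure P ?H + emeasure P ?L < ennreal (\<beta> / 2) + ennreal (\<beta> / 2)"
        using False by (intro add_strict_mono) (auto simp: not_le)
      also have "\<dots> = ennreal \<beta>" using \<beta> by (simp add: ennreal_plus[symmetric] del: ennreal_plus)
      finally show False using HL by simp
    qed
    have "ennreal (exp (- s) * (\<beta> / 2)) \<le> ?Z"
      using \<beta> by (subst ennreal_mult') (auto intro!: order_trans[OF _ Z] mult_left_mono L)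
    then have "?J / ?Z \<le> ?J / ennreal (exp (- s) * (\<beta> / 2))"
      unfolding divide_ennreal_def by (intro mult_left_mono ennreal_inverse_antimono) auto
    also have "\<dots> = ennreal (2 / \<beta> * exp s) * ?J"
      using \<beta> by (subst divide_ennreal_def, subst inverse_ennreal) (auto simp: exp_minus field_simps)
    finally show ?thesis unfolding PF by (rule order_trans) simp
  qed
qed

section \<open>Averaging over noise and matrix for a fixed signal\<close>

lemma nn_integral_swap3:
  assumes "sigma_finite_measure M" "sigma_finite_measure N" "sigma_finite_measure P"
    and f[measurable]: "(\<lambda>(x, y, z). f x y z) \<in> borel_measurable (M \<Otimes>\<^sub>M N \<Otimes>\<^sub>M P)"
  shows "(\<integral>\<^sup>+x. (\<integral>\<^sup>+y. (\<integral>\<^sup>+z. f x y z \<partial>P) \<partial>N) \<partial>M) = (\<integral>\<^sup>+z. (\<integral>\<^sup>+x. (\<integral>\<^sup>+y. f x y z \<partial>N) \<partial>M) \<partial>P)"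
proof -
  interpret M: sigma_finite_measure M by fact
  interpret N: sigma_finite_measure N by fact
  interpret P: sigma_finite_measure P by fact
  interpret NP: pair_sigma_finite P N ..
  interpret MP: pair_sigma_finite P M ..
  have [measurable (raw)]: "(\<lambda>p. f (g p) (h p) (k p)) \<in> borel_measurable Q"
    if [measurable]: "g \<in> Q \<rightarrow>\<^sub>M M" "h \<in> Q \<rightarrow>\<^sub>M N" "k \<in> Q \<rightarrow>\<^sub>M P"
    for g :: "'q \<Rightarrow> _" and h k Q
    using measurable_compose[OF _ f, of "\<lambda>p. (g p, h p, k p)" Q] by simp
  have "(\<integral>\<^sup>+y. (\<integral>\<^sup>+z. f x y z \<partial>P) \<partial>N) = (\<integral>\<^sup>+z. (\<integral>\<^sup>+y. f x y z \<partial>N) \<partial>P)" if [measurable]: "x \<in> space M" for x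
    by (rule NP.Fubini') measurable
  then have "(\<integral>\<^sup>+x. (\<integral>\<^sup>+y. (\<integral>\<^sup>+z. f x y z \<partial>P) \<partial>N) \<partial>M) = (\<integral>\<^sup>+x. (\<integral>\<^sup>+z. (\<integral>\<^sup>+y. f x y z \<partial>N) \<partial>P) \<partial>M)"
    by (intro nn_integral_cong)
  also have "\<dots> = (\<integral>\<^sup>+z. (\<integral>\<^sup>+x. (\<integral>\<^sup>+y. f x y z \<partial>N) \<partial>M) \<partial>P)"
    by (rule MP.Fubini') measurable
  finally show ?thesis .
qed

text \<open>Fubini fixes the candidate \<open>x\<close> while noise and matrix are averaged, so the
  exact moment applies point by point. The result is a \<open>P\<close>-average over
  \<open>B\<close>, hence the factor \<open>emeasure P B\<close>.\<close>

lemma nn_integral_exp_misfit_le: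
  fixes k \<sigma> :: real
  assumes m: "m \<ge> 1" and \<sigma>: "\<sigma> > 0" and P: "P \<in> space (prob_algebra (vec_space n))"
    and u[measurable]: "u \<in> space (vec_space n)" and B[measurable]: "B \<in> sets (vec_space n)"
    and q: "q > 0" "\<And>x. x \<in> B \<Longrightarrow> 1 + k * ((l2_dist n u x)\<^sup>2 + \<sigma>\<^sup>2) / \<sigma>\<^sup>2 \<ge> q"
  shows "(\<integral>\<^sup>+\<xi>. (\<integral>\<^sup>+A. (\<integral>\<^sup>+x. ennreal (exp (- k * misfit m n \<sigma> (vec_add m (mat_vec m n A u) \<xi>) A x))
      * indicator B x \<partial>P) \<partial>gaussian_matrix m n) \<partial>noise m \<sigma>) \<le>
    ennreal ((1 / sqrt q) ^ m) * emeasure P B"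
proof -
  let ?G = "gaussian_matrix m n" and ?N = "noise m \<sigma>"
  have N: "prob_space ?N" "sets ?N = sets (vec_space m)"
    using noise_in_prob_algebra[OF m \<sigma>] by (auto simp: space_prob_algebra)
  have G: "prob_space ?G" "sets ?G = sets (mat_space m n)"
    using gaussian_matrix_in_prob_algebra[OF m, of n] by (auto simp: space_prob_algebra)
  have P': "prob_space P" "sets P = sets (vec_space n)"
    using P by (auto simp: space_prob_algebra)
  note [measurable_cong] = N(2) G(2) P'(2)
  interpret G: prob_space ?G by (rule G)
  interpret N: prob_space ?N by (rule N)
  interpret P: prob_space P by (rule P')
  let ?e = "\<lambda>\<xi> A x. ennreal (exp (- k * misfit m n \<sigma> (vec_add m (mat_vec m n A u) \<xi>) A x))"
  have "(\<integral>\<^sup>+\<xi>. (\<integral>\<^sup>+A. (\<integral>\<^sup>+x. ?e \<xi> A x * indicator B x \<partial>P) \<partial>?G) \<partial>?N)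
     = (\<integral>\<^sup>+x. (\<integral>\<^sup>+\<xi>. (\<integral>\<^sup>+A. ?e \<xi> A x * indicator B x \<partial>?G) \<partial>?N) \<partial>P)"
    by (rule nn_integral_swap3) (auto intro: prob_space_imp_sigma_finite G N P')
  also have "\<dots> \<le> (\<integral>\<^sup>+x. ennreal ((1 / sqrt q) ^ m) * indicator B x \<partial>P)"
  proof (rule nn_integral_mono)
    fix x assume "x \<in> space P"
    then have x[measurable]: "x \<in> space (vec_space n)"
      using P'(2) sets_eq_imp_space_eq by blast
    show "(\<integral>\<^sup>+\<xi>. (\<integral>\<^sup>+A. ?e \<xi> A x * indicator B x \<partial>?G) \<partial>?N) \<le> ennreal ((1 / sqrt q) ^ m) * indicator B x"
    proof (cases "x \<in> B")
      case True
      let ?q = "1 + k * ((l2_dist n u x)\<^sup>2 + \<sigma>\<^sup>2) / \<sigma>\<^sup>2"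
      have "?q \<ge> q" "?q > 0" using q True by force+
      have "(\<integral>\<^sup>+\<xi>. (\<integral>\<^sup>+A. ?e \<xi> A x * indicator B x \<partial>?G) \<partial>?N) = ennreal ((1 / sqrt ?q) ^ m)"
        using True nn_integral_exp_misfit[OF m \<sigma> \<open>?q > 0\<close>] by simp
      also have "\<dots> \<le> ennreal ((1 / sqrt q) ^ m)"
        using \<open>?q \<ge> q\<close> q(1) by (intro ennreal_leI power_mono divide_left_mono) auto
      finally show ?thesis using True by simp
    qed simp
  qed
  also have "\<dots> = ennreal ((1 / sqrt q) ^ m) * emeasure P B"
    by (simp add: nn_integral_cmult)
  finally show ?thesis .
qed

text \<open>The two terms of the bound for a single observation are averaged with different
  exponents. With \<open>k = - \<theta>\<close> this choice of \<open>\<theta>\<close> keeps the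
  base at least \<open>1 / 2\<close> within distance \<open>a * \<sigma>\<close>; with
  \<open>k = 1\<close> the base is at least \<open>2 + C\<^sup>2\<close> beyond
  \<open>C * \<sigma>\<close>. The threshold \<open>s\<close> stays free, to balance the two terms
  later.\<close>

lemma posterior_failure_le:
  fixes \<sigma> a C s \<theta> \<rho> :: real
  assumes m: "m \<ge> 1" and \<sigma>: "\<sigma> > 0" and P: "P \<in> space (prob_algebra (vec_space n))"
    and u[measurable]: "u \<in> space (vec_space n)"
    and \<rho>: "\<rho> > 0" "emeasure P {x \<in> space (vec_space n). l2_dist n u x \<le> a * \<sigma>} \<ge> ennreal \<rho>"
    and a: "a > 0" and C: "C > 0" and \<theta>: "\<theta> = 1 / (2 * (1 + a\<^sup>2))"
  shows "(\<integral>\<^sup>+\<xi>. (\<integral>\<^sup>+A. emeasure (posterior m n \<sigma> P (vec_add m (mat_vec m n A u) \<xi>, A))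
      {x \<in> space (vec_space n). \<not> l2_dist n u x \<le> C * \<sigma>} \<partial>gaussian_matrix m n) \<partial>noise m \<sigma>) \<le>
    ennreal (2 * exp (- \<theta> * s) * sqrt 2 ^ m + 2 / \<rho> * exp s * (1 / sqrt (2 + C\<^sup>2)) ^ m)"
proof -
  let ?V = "vec_space n" and ?G = "gaussian_matrix m n" and ?N = "noise m \<sigma>"
  have N: "prob_space ?N" "sets ?N = sets (vec_space m)"
    using noise_in_prob_algebra[OF m \<sigma>] by (auto simp: space_prob_algebra)
  have G: "prob_space ?G" "sets ?G = sets (mat_space m n)"
    using gaussian_matrix_in_prob_algebra[OF m, of n] by (auto simp: space_prob_algebra)
  have P': "prob_space P" "sets P = sets (vec_space n)"
    using P by (auto simp: space_prob_algebra)
  note [measurable_cong] = N(2) G(2) P'(2)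
  interpret G: prob_space ?G by (rule G)
  interpret N: prob_space ?N by (rule N)
  interpret P: prob_space P by (rule P')
  define B where "B = {x \<in> space ?V. l2_dist n u x \<le> a * \<sigma>}"
  define F where "F = {x \<in> space ?V. \<not> l2_dist n u x \<le> C * \<sigma>}"
  have B[measurable]: "B \<in> sets ?V" unfolding B_def by measurable
  have F[measurable]: "F \<in> sets ?V" unfolding F_def by measurable
  define \<beta> where "\<beta> = measure P B"
  have \<beta>: "emeasure P B = ennreal \<beta>" by (simp add: \<beta>_def P.emeasure_eq_measure)
  have \<beta>\<rho>: "\<rho> \<le> \<beta>"
    using \<rho>(2) by (simp add: B_def[symmetric] \<beta> \<beta>_def)
  then have \<beta>0: "\<beta> > 0" using \<rho>(1) by simp
  have \<theta>0: "\<theta> > 0" unfolding \<theta> by (intro divide_pos_pos) (auto intro: add_pos_nonneg)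
  let ?y = "\<lambda>\<xi> A. vec_add m (mat_vec m n A u) \<xi>"
  let ?I = "\<lambda>\<xi> A. \<integral>\<^sup>+x. ennreal (exp (- (- \<theta>) * misfit m n \<sigma> (?y \<xi> A) A x)) * indicator B x \<partial>P"
  let ?J = "\<lambda>\<xi> A. \<integral>\<^sup>+x. ennreal (exp (- 1 * misfit m n \<sigma> (?y \<xi> A) A x)) * indicator F x \<partial>P"
  let ?c = "ennreal (2 / \<beta> * exp (- \<theta> * s))" and ?d = "ennreal (2 / \<beta> * exp s)"
  have "(\<integral>\<^sup>+\<xi>. (\<integral>\<^sup>+A. emeasure (posterior m n \<sigma> P (?y \<xi> A, A)) F \<partial>?G) \<partial>?N)
      \<le> (\<integral>\<^sup>+\<xi>. (\<integral>\<^sup>+A. ?c * ?I \<xi> A + ?d * ?J \<xi> A \<partial>?G) \<partial>?N)"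
  proof (intro nn_integral_mono)
    fix \<xi> A assume "\<xi> \<in> space ?N" "A \<in> space ?G"
    then have [measurable]: "\<xi> \<in> space (vec_space m)" "A \<in> space (mat_space m n)"
      using N(2) G(2) sets_eq_imp_space_eq by blast+
    have y: "?y \<xi> A \<in> space (vec_space m)"
      by (simp add: vec_space_def vec_add_def space_PiM)
    show "emeasure (posterior m n \<sigma> P (?y \<xi> A, A)) F \<le> ?c * ?I \<xi> A + ?d * ?J \<xi> A"
      unfolding minus_minus mult_minus1
      by (rule posterior_mass_le[OF P _ y B F \<beta>0 \<beta> \<theta>0]) measurable
  qed
  also have "\<dots> = ?c * (\<integral>\<^sup>+\<xi>. (\<integral>\<^sup>+A. ?I \<xi> A \<partial>?G) \<partial>?N) + ?d * (\<integral>\<^sup>+\<xi>. (\<integral>\<^sup>+A. ?J \<xi> A \<partial>?G) \<partial>?N)"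
  proof -
    have "(\<integral>\<^sup>+A. ?c * ?I \<xi> A + ?d * ?J \<xi> A \<partial>?G) = ?c * (\<integral>\<^sup>+A. ?I \<xi> A \<partial>?G) + ?d * (\<integral>\<^sup>+A. ?J \<xi> A \<partial>?G)"
      if "\<xi> \<in> space ?N" for \<xi>
    proof -
      have [measurable]: "\<xi> \<in> space (vec_space m)"
        using that N(2) sets_eq_imp_space_eq by blast
      show ?thesis
        by (subst nn_integral_add) (measurable, subst (1 2) nn_integral_cmult, auto)
    qed
    then have "(\<integral>\<^sup>+\<xi>. (\<integral>\<^sup>+A. ?c * ?I \<xi> A + ?d * ?J \<xi> A \<partial>?G) \<partial>?N)
       = (\<integral>\<^sup>+\<xi>. ?c * (\<integral>\<^sup>+A. ?I \<xi> A \<partial>?G) + ?d * (\<integral>\<^sup>+A. ?J \<xi> A \<partial>?G) \<partial>?N)"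
      by (intro nn_integral_cong)
    also have "\<dots> = ?c * (\<integral>\<^sup>+\<xi>. (\<integral>\<^sup>+A. ?I \<xi> A \<partial>?G) \<partial>?N) + ?d * (\<integral>\<^sup>+\<xi>. (\<integral>\<^sup>+A. ?J \<xi> A \<partial>?G) \<partial>?N)"
      by (subst nn_integral_add) (measurable, subst (1 2) nn_integral_cmult, auto)
    finally show ?thesis .
  qed
  also have "\<dots> \<le> ?c * (ennreal ((1 / sqrt (1 / 2)) ^ m) * emeasure P B)
      + ?d * (ennreal ((1 / sqrt (2 + C\<^sup>2)) ^ m) * emeasure P F)"
  proof (rule add_mono; rule mult_left_mono[OF nn_integral_exp_misfit_le[OF m \<sigma> P u]])
    fix x assume "x \<in> B"
    then have "(l2_dist n u x)\<^sup>2 \<le> (a * \<sigma>)\<^sup>2"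
      by (intro power_mono) (auto simp: B_def l2_dist_def)
    then have "((l2_dist n u x)\<^sup>2 + \<sigma>\<^sup>2) / \<sigma>\<^sup>2 \<le> 1 + a\<^sup>2"
      using \<sigma> by (simp add: field_simps power_mult_distrib)
    then have "\<theta> * (((l2_dist n u x)\<^sup>2 + \<sigma>\<^sup>2) / \<sigma>\<^sup>2) \<le> \<theta> * (1 + a\<^sup>2)"
      using \<theta>0 by (intro mult_left_mono) auto
    also have "\<theta> * (1 + a\<^sup>2) = 1 / 2"
    proof -
      have "1 + a\<^sup>2 \<noteq> 0" by (metis add_pos_nonneg less_numeral_extra(1) less_numeral_extra(3) zero_le_power2)
      then show ?thesis by (simp add: \<theta>)
    qed
    finally show "1 / 2 \<le> 1 + - \<theta> * ((l2_dist n u x)\<^sup>2 + \<sigma>\<^sup>2) / \<sigma>\<^sup>2" by simp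
  next
    fix x assume "x \<in> F"
    then have "(C * \<sigma>)\<^sup>2 \<le> (l2_dist n u x)\<^sup>2"
      using C \<sigma> by (intro power_mono) (auto simp: F_def)
    then show "2 + C\<^sup>2 \<le> 1 + 1 * ((l2_dist n u x)\<^sup>2 + \<sigma>\<^sup>2) / \<sigma>\<^sup>2"
      using \<sigma> by (simp add: field_simps power_mult_distrib)
  qed (auto intro: add_pos_nonneg)
  also have "\<dots> \<le> ennreal (2 * exp (- \<theta> * s) * sqrt 2 ^ m) + ennreal (2 / \<rho> * exp s * (1 / sqrt (2 + C\<^sup>2)) ^ m)"
  proof (rule add_mono)
    \<comment> \<open>The mass of \<open>B\<close> cancels \<open>1 / \<beta>\<close>, so a small
      prior mass near \<open>u\<close> does not hurt this term.\<close>
    have "?c * (ennreal ((1 / sqrt (1 / 2)) ^ m) * emeasure P B)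
        = ennreal (2 / \<beta> * exp (- \<theta> * s) * ((1 / sqrt (1 / 2)) ^ m * \<beta>))"
      using \<beta>0 unfolding \<beta> by (simp add: ennreal_mult'[symmetric])
    also have "2 / \<beta> * exp (- \<theta> * s) * ((1 / sqrt (1 / 2)) ^ m * \<beta>) = 2 * exp (- \<theta> * s) * sqrt 2 ^ m"
      using \<beta>0 by (simp add: real_sqrt_divide)
    finally show "?c * (ennreal ((1 / sqrt (1 / 2)) ^ m) * emeasure P B) \<le> ennreal (2 * exp (- \<theta> * s) * sqrt 2 ^ m)"
      by simp
    \<comment> \<open>Nothing cancels here: \<open>F\<close> may carry almost all of
      \<open>P\<close>, and \<open>1 / \<rho>\<close> has to be beaten by the decay in
      \<open>m\<close>.\<close>
    have "?d * (ennreal ((1 / sqrt (2 + C\<^sup>2)) ^ m) * emeasure P F)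
      \<le> ?d * (ennreal ((1 / sqrt (2 + C\<^sup>2)) ^ m) * 1)"
      by (intro mult_left_mono P.emeasure_le_1) auto
    also have "\<dots> = ennreal (2 / \<beta> * exp s * (1 / sqrt (2 + C\<^sup>2)) ^ m)"
      using \<beta>0 by (simp add: ennreal_mult'[symmetric])
    also have "\<dots> \<le> ennreal (2 / \<rho> * exp s * (1 / sqrt (2 + C\<^sup>2)) ^ m)"
      using \<beta>0 \<rho>(1) \<beta>\<rho> by (intro ennreal_leI mult_right_mono divide_left_mono) auto
    finally show "?d * (ennreal ((1 / sqrt (2 + C\<^sup>2)) ^ m) * emeasure P F)
      \<le> ennreal (2 / \<rho> * exp s * (1 / sqrt (2 + C\<^sup>2)) ^ m)" .
  qed
  also have "\<dots> = ennreal (2 * exp (- \<theta> * s) * sqrt 2 ^ m + 2 / \<rho> * exp s * (1 / sqrt (2 + C\<^sup>2)) ^ m)"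
    using \<rho>(1) by (intro ennreal_plus[symmetric]) (auto intro!: mult_nonneg_nonneg)
  finally show ?thesis unfolding F_def .
qed

section \<open>Change of measure to a reference observation\<close>

text \<open>
  Cauchy-Schwarz in the form \<open>g f \<le> g\<^sup>2 / (4 D) + D f\<close>, which needs no finiteness of integrals.
\<close>

lemma nn_integral_change_of_measure_ge:
  fixes g :: "'a \<Rightarrow> real" and f :: "'a \<Rightarrow> ennreal" and D :: real
  assumes [measurable]: "g \<in> borel_measurable Q" "f \<in> borel_measurable Q"
    and g: "\<And>y. g y \<ge> 0" and f: "\<And>y. y \<in> space Q \<Longrightarrow> f y \<le> 1" and D: "D > 0"
    and chi: "(\<integral>\<^sup>+y. ennreal ((g y)\<^sup>2) \<partial>Q) \<le> ennreal D"
    and half: "(\<integral>\<^sup>+y. f y \<partial>density Q g) \<ge> ennreal (1 / 2)"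
  shows "(\<integral>\<^sup>+y. f y \<partial>Q) \<ge> ennreal (1 / (4 * D))"
proof (rule ccontr)
  assume "\<not> (\<integral>\<^sup>+y. f y \<partial>Q) \<ge> ennreal (1 / (4 * D))"
  then have less: "(\<integral>\<^sup>+y. f y \<partial>Q) < ennreal (1 / (4 * D))" by simp
  have "ennreal (1 / 2) \<le> (\<integral>\<^sup>+y. ennreal (g y) * f y \<partial>Q)"
    using half by (simp add: nn_integral_density)
  \<comment> \<open>The weight \<open>1 / (4 * D)\<close> limits the second-moment term to
    \<open>1 / 4\<close>, so the remaining \<open>1 / 4\<close> must come from \<open>D\<close>
    times the integral of \<open>f\<close>.\<close>
  also have "\<dots> \<le> (\<integral>\<^sup>+y. ennreal (1 / (4 * D)) * ennreal ((g y)\<^sup>2) + ennreal D * f y \<partial>Q)"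
  proof (rule nn_integral_mono)
    fix y assume "y \<in> space Q"
    then obtain h where h: "f y = ennreal h" "0 \<le> h" "h \<le> 1"
      using f[of y] by (cases "f y") (auto simp: top_unique)
    have "0 \<le> (g y - 2 * D * h)\<^sup>2 / (4 * D)"
      using D by (intro divide_nonneg_nonneg) auto
    also have "\<dots> = 1 / (4 * D) * (g y)\<^sup>2 + D * h\<^sup>2 - g y * h"
      using D by (simp add: field_simps power2_eq_square)
    finally have "g y * h \<le> 1 / (4 * D) * (g y)\<^sup>2 + D * h\<^sup>2" by simp
    \<comment> \<open>Here \<open>f \<le> 1\<close> replaces the second moment of \<open>f\<close>
      by its integral.\<close>
    also have "D * h\<^sup>2 \<le> D * h"
      using D h by (simp add: power2_eq_square mult_left_le)
    finally show "ennreal (g y) * f y \<le> ennreal (1 / (4 * D)) * ennreal ((g y)\<^sup>2) + ennreal D * f y"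
      using D h g[of y] by (simp add: h ennreal_mult'[symmetric] ennreal_plus[symmetric] del: ennreal_plus)
  qed
  also have "\<dots> = ennreal (1 / (4 * D)) * (\<integral>\<^sup>+y. ennreal ((g y)\<^sup>2) \<partial>Q) + ennreal D * (\<integral>\<^sup>+y. f y \<partial>Q)"
    by (simp add: nn_integral_add nn_integral_cmult)
  also have "\<dots> \<le> ennreal (1 / (4 * D)) * ennreal D + ennreal D * (\<integral>\<^sup>+y. f y \<partial>Q)"
    by (intro add_right_mono mult_left_mono chi) auto
  also have "\<dots> < ennreal (1 / (4 * D)) * ennreal D + ennreal D * ennreal (1 / (4 * D))"
    using less D by (intro ennreal_add_left_cancel_less[THEN iffD2] conjI ennreal_mult_strict_left_mono)
      (auto simp: ennreal_mult'[symmetric])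
  also have "\<dots> = ennreal (1 / 2)"
    using D by (simp add: ennreal_mult'[symmetric] ennreal_plus[symmetric] del: ennreal_plus)
  finally show False by simp
qed

text \<open>Follows from \<open>1 - 1 / t \<le> ln t\<close> at \<open>t = 1 + S\<close>. It absorbs
  the exponential cost of moving a mean into one more factor \<open>1 + S\<close>.\<close>

lemma exp_ratio_le_one_plus:
  fixes S :: real
  assumes "S \<ge> 0"
  shows "exp (S / (1 + 2 * S)) \<le> 1 + S"
proof -
  have "S / (1 + 2 * S) \<le> S / (1 + S)"
    using assms by (intro divide_left_mono mult_pos_pos) auto
  also have "\<dots> = - (inverse (1 + S) - 1)"
    using assms by (simp add: field_simps)
  also have "\<dots> \<le> - ln (inverse (1 + S))"
    using ln_le_minus_one[of "inverse (1 + S)"] assms by simp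
  also have "\<dots> = ln (1 + S)"
    using assms by (simp add: ln_inverse)
  finally have "exp (S / (1 + 2 * S)) \<le> exp (ln (1 + S))" by simp
  then show ?thesis using assms by simp
qed

text \<open>The squared ratio times the reference density is \<open>c\<close> times the Gaussian
  density with mean \<open>\<eta>\<close> and deviation \<open>v\<close>, since
  \<open>2 / \<tau>\<^sup>2 - 1 / s\<^sup>2 = 1 / v\<^sup>2\<close>. With equal variances the moment
  would be \<open>exp ((\<mu> - \<zeta>)\<^sup>2 / \<tau>\<^sup>2)\<close>, possibly as large as
  \<open>exp S\<close>.\<close>

lemma nn_integral_normal_density_sq_ratio_le:
  fixes \<mu> \<zeta> \<tau> S :: real
  defines "s \<equiv> \<tau> * sqrt (1 + S)"
  assumes \<tau>: "\<tau> > 0" and S: "S \<ge> 0" and d: "(\<mu> - \<zeta>)\<^sup>2 \<le> S * \<tau>\<^sup>2"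
  shows "(\<integral>\<^sup>+t. ennreal ((normal_density \<mu> \<tau> t / normal_density \<zeta> s t)\<^sup>2)
    \<partial>density lborel (normal_density \<zeta> s)) \<le> ennreal ((1 + S)\<^sup>2)"
proof -
  define a where "a = \<mu> - \<zeta>"
  define v where "v = \<tau> * sqrt ((1 + S) / (1 + 2 * S))"
  define \<eta> where "\<eta> = \<zeta> + 2 * a * (1 + S) / (1 + 2 * S)"
  define c where "c = (1 + S) / sqrt (1 + 2 * S) * exp (a\<^sup>2 / (\<tau>\<^sup>2 * (1 + 2 * S)))"
  have pos: "s > 0" "v > 0" "1 + S > 0" "1 + 2 * S > 0"
    using \<tau> S by (auto simp: s_def v_def)
  have s2: "s\<^sup>2 = \<tau>\<^sup>2 * (1 + S)" and v2: "v\<^sup>2 = \<tau>\<^sup>2 * (1 + S) / (1 + 2 * S)"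
    using pos by (auto simp: s_def v_def power_mult_distrib)
  have expo: "- (t - \<mu>)\<^sup>2 / (2 * \<tau>\<^sup>2) * 2 + (t - \<zeta>)\<^sup>2 / (2 * s\<^sup>2)
      = a\<^sup>2 / (\<tau>\<^sup>2 * (1 + 2 * S)) - (t - \<eta>)\<^sup>2 / (2 * v\<^sup>2)" for t
  proof -
    define x where "x = t - \<zeta>"
    have "(t - \<mu>) = x - a" by (simp add: x_def a_def)
    moreover have "t - \<eta> = ((1 + 2 * S) * x - 2 * a * (1 + S)) / (1 + 2 * S)"
      using pos by (simp add: x_def \<eta>_def field_simps)
    moreover have "- (x - a)\<^sup>2 / (2 * \<tau>\<^sup>2) * 2 + x\<^sup>2 / (2 * (\<tau>\<^sup>2 * (1 + S)))
      = a\<^sup>2 / (\<tau>\<^sup>2 * (1 + 2 * S)) - (((1 + 2 * S) * x - 2 * a * (1 + S)) / (1 + 2 * S))\<^sup>2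
          / (2 * (\<tau>\<^sup>2 * (1 + S) / (1 + 2 * S)))"
    proof -
      define p q where "p = 1 + S" and "q = 1 + 2 * S"
      have pq: "p > 0" "q > 0" and qp: "q = 2 * p - 1" using pos by (auto simp: p_def q_def)
      have "- (x - a)\<^sup>2 / (2 * \<tau>\<^sup>2) * 2 + x\<^sup>2 / (2 * (\<tau>\<^sup>2 * p))
        = (- 2 * p * q * (x - a)\<^sup>2 + q * x\<^sup>2) / (2 * \<tau>\<^sup>2 * p * q)"
        using pq \<tau> by (simp add: field_simps)
      also have "- 2 * p * q * (x - a)\<^sup>2 + q * x\<^sup>2 = 2 * p * a\<^sup>2 - (q * x - 2 * a * p)\<^sup>2"
        unfolding qp by algebra
      also have "(2 * p * a\<^sup>2 - (q * x - 2 * a * p)\<^sup>2) / (2 * \<tau>\<^sup>2 * p * q)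
        = a\<^sup>2 / (\<tau>\<^sup>2 * q) - ((q * x - 2 * a * p) / q)\<^sup>2 / (2 * (\<tau>\<^sup>2 * p / q))"
      proof -
        have "a\<^sup>2 / (\<tau>\<^sup>2 * q) - (X / q)\<^sup>2 / (2 * (\<tau>\<^sup>2 * p / q)) = (2 * p * a\<^sup>2 - X\<^sup>2) / (2 * \<tau>\<^sup>2 * p * q)" for X
          using pq \<tau> by (simp add: field_simps power2_eq_square)
        then show ?thesis by simp
      qed
      finally show ?thesis unfolding p_def q_def .
    qed
    ultimately show ?thesis by (simp add: s2 v2 x_def[symmetric])
  qed
  have pref: "(1 / sqrt (2 * pi * \<tau>\<^sup>2))\<^sup>2 / (1 / sqrt (2 * pi * s\<^sup>2))
      = (1 + S) / sqrt (1 + 2 * S) * (1 / sqrt (2 * pi * v\<^sup>2))"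
  proof -
    have e: "sqrt (2 * pi * s\<^sup>2) = sqrt (2 * pi) * \<tau> * sqrt (1 + S)"
      "sqrt (2 * pi * v\<^sup>2) = sqrt (2 * pi) * \<tau> * sqrt (1 + S) / sqrt (1 + 2 * S)"
      "(1 / sqrt (2 * pi * \<tau>\<^sup>2))\<^sup>2 = 1 / (sqrt (2 * pi) * \<tau>)\<^sup>2"
      using \<tau> pos by (auto simp: s2 v2 real_sqrt_mult real_sqrt_divide power_divide power_mult_distrib)
    have "1 / (k * \<tau>)\<^sup>2 / (1 / (k * \<tau> * u)) = u * u / w * (1 / (k * \<tau> * u / w))"
      if "k > 0" "u > 0" "w > 0" for k u w :: real
      using \<tau> that by (simp add: field_simps power2_eq_square)
    from this[of "sqrt (2 * pi)" "sqrt (1 + S)" "sqrt (1 + 2 * S)"] show ?thesis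
      unfolding e using pos by simp
  qed
  have dens: "normal_density \<zeta> s t * (normal_density \<mu> \<tau> t / normal_density \<zeta> s t)\<^sup>2 = c * normal_density \<eta> v t" for t
  proof -
    have nz: "normal_density \<zeta> s t > 0" using pos by (simp add: normal_density_pos)
    have "normal_density \<zeta> s t * (normal_density \<mu> \<tau> t / normal_density \<zeta> s t)\<^sup>2
       = (normal_density \<mu> \<tau> t)\<^sup>2 / normal_density \<zeta> s t"
      using nz by (simp add: power2_eq_square)
    also have "\<dots> = (1 / sqrt (2 * pi * \<tau>\<^sup>2))\<^sup>2 / (1 / sqrt (2 * pi * s\<^sup>2)) *
        exp (- (t - \<mu>)\<^sup>2 / (2 * \<tau>\<^sup>2) * 2 + (t - \<zeta>)\<^sup>2 / (2 * s\<^sup>2))"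
    proof -
      have "(p * exp (- x))\<^sup>2 / (q * exp (- y)) = p\<^sup>2 / q * exp (- x * 2 + y)" for p q x y :: real
      proof -
        have "exp (- x * 2 + y) = exp (- x) * exp (- x) * exp y" by (simp add: exp_add[symmetric])
        then show ?thesis by (simp add: power2_eq_square exp_minus[of y] divide_inverse)
      qed
      from this[of "1 / sqrt (2 * pi * \<tau>\<^sup>2)" "(t - \<mu>)\<^sup>2 / (2 * \<tau>\<^sup>2)"
          "1 / sqrt (2 * pi * s\<^sup>2)" "(t - \<zeta>)\<^sup>2 / (2 * s\<^sup>2)"]
      show ?thesis by (simp only: normal_density_def minus_divide_left)
    qed
    also have "\<dots> = (1 + S) / sqrt (1 + 2 * S) * (1 / sqrt (2 * pi * v\<^sup>2)) *
        (exp (a\<^sup>2 / (\<tau>\<^sup>2 * (1 + 2 * S))) * exp (- (t - \<eta>)\<^sup>2 / (2 * v\<^sup>2)))"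
      unfolding pref expo by (simp add: exp_add[symmetric])
    also have "\<dots> = c * normal_density \<eta> v t"
      unfolding normal_density_def c_def by simp
    finally show ?thesis .
  qed
  have c0: "c \<ge> 0" using pos by (simp add: c_def)
  have "(\<integral>\<^sup>+t. ennreal ((normal_density \<mu> \<tau> t / normal_density \<zeta> s t)\<^sup>2)
    \<partial>density lborel (normal_density \<zeta> s)) =
    (\<integral>\<^sup>+t. ennreal (normal_density \<zeta> s t * (normal_density \<mu> \<tau> t / normal_density \<zeta> s t)\<^sup>2) \<partial>lborel)"
    by (subst nn_integral_density) (auto simp: ennreal_mult')
  also have "\<dots> = (\<integral>\<^sup>+t. ennreal c * ennreal (normal_density \<eta> v t) \<partial>lborel)"
    unfolding dens by (intro nn_integral_cong ennreal_mult' c0)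
  also have "\<dots> = ennreal c"
    using pos by (simp add: nn_integral_cmult nn_integral_normal_density)
  also have "c \<le> (1 + S) * exp (S / (1 + 2 * S))"
    unfolding c_def
  proof (intro mult_mono)
    have "(1 + S) / sqrt (1 + 2 * S) \<le> (1 + S) / 1"
      using S by (intro divide_left_mono) auto
    then show "(1 + S) / sqrt (1 + 2 * S) \<le> 1 + S" by simp
    have "a\<^sup>2 / (\<tau>\<^sup>2 * (1 + 2 * S)) \<le> (S * \<tau>\<^sup>2) / (\<tau>\<^sup>2 * (1 + 2 * S))"
      using d pos by (intro divide_right_mono) (auto simp: a_def)
    also have "\<dots> = S / (1 + 2 * S)" using \<tau> by simp
    finally show "exp (a\<^sup>2 / (\<tau>\<^sup>2 * (1 + 2 * S))) \<le> exp (S / (1 + 2 * S))" by simp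
  qed (use S in auto)
  also have "\<dots> \<le> (1 + S)\<^sup>2"
    using exp_ratio_le_one_plus[OF S] S by (simp add: power2_eq_square)
  finally show ?thesis by (simp add: ennreal_leI)
qed

section \<open>Observation laws as densities with respect to a product Gaussian\<close>

lemma density_PiM_prod:
  fixes g :: "'i \<Rightarrow> 'a \<Rightarrow> ennreal"
  assumes "finite I" and M: "\<And>i. prob_space (M i)" and g[measurable]: "\<And>i. g i \<in> borel_measurable (M i)"
    and Mg: "\<And>i. prob_space (density (M i) (g i))"
  shows "density (PiM I M) (\<lambda>x. \<Prod>i\<in>I. g i (x i)) = PiM I (\<lambda>i. density (M i) (g i))"
proof -
  interpret M: product_sigma_finite M
    by (rule product_sigma_finite.intro) (rule prob_space_imp_sigma_finite[OF M])
  interpret N: product_sigma_finite "\<lambda>i. density (M i) (g i)"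
    by (rule product_sigma_finite.intro) (rule prob_space_imp_sigma_finite[OF Mg])
  show ?thesis
  proof (rule N.PiM_eqI[OF \<open>finite I\<close>])
    show "sets (density (PiM I M) (\<lambda>x. \<Prod>i\<in>I. g i (x i))) = sets (PiM I (\<lambda>i. density (M i) (g i)))"
      by (simp, rule sets_PiM_cong) auto
    fix A assume A: "\<And>i. i \<in> I \<Longrightarrow> A i \<in> sets (density (M i) (g i))"
    then have A'[measurable]: "\<And>i. i \<in> I \<Longrightarrow> A i \<in> sets (M i)" by simp
    have "emeasure (density (PiM I M) (\<lambda>x. \<Prod>i\<in>I. g i (x i))) (Pi\<^sub>E I A)
       = (\<integral>\<^sup>+x. (\<Prod>i\<in>I. g i (x i)) * indicator (Pi\<^sub>E I A) x \<partial>PiM I M)"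
      by (rule emeasure_density) (use A' \<open>finite I\<close> in \<open>auto intro!: sets_PiM_I_finite borel_measurable_prod_ennreal\<close>)
    also have "\<dots> = (\<integral>\<^sup>+x. (\<Prod>i\<in>I. g i (x i) * indicator (A i) (x i)) \<partial>PiM I M)"
      by (intro nn_integral_cong)
         (use \<open>finite I\<close> in \<open>auto simp: prod.distrib space_PiM PiE_iff indicator_def prod_zero_iff\<close>)
    also have "\<dots> = (\<Prod>i\<in>I. \<integral>\<^sup>+t. g i t * indicator (A i) t \<partial>M i)"
      by (rule M.product_nn_integral_prod[OF \<open>finite I\<close>]) (use A' in auto)
    also have "\<dots> = (\<Prod>i\<in>I. emeasure (density (M i) (g i)) (A i))"
      by (intro prod.cong refl emeasure_density[symmetric]) (use A' in auto)
    finally show "emeasure (density (PiM I M) (\<lambda>x. \<Prod>i\<in>I. g i (x i))) (Pi\<^sub>E I A) = \<dots>" .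
  qed
qed

lemma distr_noise_vec_add:
  assumes m: "m \<ge> 1" and \<sigma>: "\<sigma> > 0" and \<mu>: "\<mu> \<in> space (vec_space m)"
  shows "distr (noise m \<sigma>) (vec_space m) (vec_add m \<mu>)
    = PiM {..<m} (\<lambda>i. density lborel (normal_density (\<mu> i) (\<sigma> / sqrt (real m))))"
proof -
  let ?\<tau> = "\<sigma> / sqrt (real m)"
  let ?N = "\<lambda>i. density lborel (normal_density (\<mu> i) ?\<tau>)"
  let ?K = "density lborel (normal_density 0 ?\<tau>)"
  have \<tau>: "?\<tau> > 0" using m \<sigma> by simp
  interpret N: product_sigma_finite ?N
    by (rule product_sigma_finite.intro) (rule prob_space_imp_sigma_finite[OF prob_space_normal_density[OF \<tau>]])
  interpret K: product_sigma_finite "\<lambda>_::nat. ?K"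
    by (rule product_sigma_finite.intro) (rule prob_space_imp_sigma_finite[OF prob_space_normal_density[OF \<tau>]])
  have sN[measurable_cong]: "sets (noise m \<sigma>) = sets (vec_space m)"
    using noise_in_prob_algebra[OF m \<sigma>] by (simp add: space_prob_algebra)
  note [measurable] = \<mu>
  have shift: "emeasure ?K ((+) (\<mu> i) -` A) = emeasure (?N i) A" if [measurable]: "A \<in> sets borel" for i A
  proof -
    have "emeasure (?N i) A = (\<integral>\<^sup>+t. ennreal (normal_density (\<mu> i) ?\<tau> t) * indicator A t \<partial>lborel)"
      by (simp add: emeasure_density)
    also have "\<dots> = (\<integral>\<^sup>+t. ennreal (normal_density (\<mu> i) ?\<tau> (\<mu> i + 1 * t)) * indicator A (\<mu> i + 1 * t) \<partial>lborel)"
      by (subst nn_integral_real_affine[where c=1 and t="\<mu> i"]) auto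
    also have "\<dots> = (\<integral>\<^sup>+t. ennreal (normal_density 0 ?\<tau> t) * indicator ((+) (\<mu> i) -` A) t \<partial>lborel)"
      by (intro nn_integral_cong) (auto simp: normal_density_def split: split_indicator)
    also have "\<dots> = emeasure ?K ((+) (\<mu> i) -` A)"
      by (subst emeasure_density) (auto intro: measurable_sets_borel[of "(+) (\<mu> i)" borel A])
    finally show ?thesis by simp
  qed
  show ?thesis
  proof (rule N.PiM_eqI)
    show "sets (distr (noise m \<sigma>) (vec_space m) (vec_add m \<mu>)) = sets (PiM {..<m} ?N)"
      by (auto simp: vec_space_def intro!: sets_PiM_cong)
    fix A assume "\<And>i. i \<in> {..<m} \<Longrightarrow> A i \<in> sets (?N i)"
    then have A: "A i \<in> sets borel" if "i < m" for i using that by simp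
    have B: "Pi\<^sub>E {..<m} A \<in> sets (vec_space m)"
      unfolding vec_space_def using A by (intro sets_PiM_I_finite) auto
    have "emeasure (distr (noise m \<sigma>) (vec_space m) (vec_add m \<mu>)) (Pi\<^sub>E {..<m} A)
      = emeasure (noise m \<sigma>) (vec_add m \<mu> -` Pi\<^sub>E {..<m} A \<inter> space (noise m \<sigma>))"
      by (rule emeasure_distr[OF _ B]) measurable
    also have "vec_add m \<mu> -` Pi\<^sub>E {..<m} A \<inter> space (noise m \<sigma>) = (\<Pi>\<^sub>E i\<in>{..<m}. (+) (\<mu> i) -` A i)"
      by (auto simp: noise_def space_PiM vec_add_def PiE_iff extensional_def)
    also have "emeasure (noise m \<sigma>) \<dots> = (\<Prod>i<m. emeasure ?K ((+) (\<mu> i) -` A i))"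
      unfolding noise_def
      by (rule K.emeasure_PiM) (use A in \<open>auto intro: measurable_sets_borel[of "(+) _" borel]\<close>)
    also have "\<dots> = (\<Prod>i<m. emeasure (?N i) (A i))"
      using A by (intro prod.cong) (auto simp: shift)
    finally show "emeasure (distr (noise m \<sigma>) (vec_space m) (vec_add m \<mu>)) (Pi\<^sub>E {..<m} A)
       = (\<Prod>i<m. emeasure (?N i) (A i))" .
  qed simp
qed

text \<open>Each coordinate of \<open>x - z\<close> is at most its Euclidean length, so the ball
  lies in a cube of half-width \<open>r\<close>, and absolute row sums bound the image of a cube.
  This is how the operator norm for the maximum norm enters.\<close>

lemma mat_vec_diff_le:
  assumes "m \<ge> 1" "i < m" "l2_dist n x z \<le> r"
  shows "\<bar>mat_vec m n A x i - mat_vec m n A z i\<bar> \<le> mat_norm_inf m n A * r"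
proof -
  have xz: "\<bar>x j - z j\<bar> \<le> r" if "j < n" for j
  proof -
    have "\<bar>x j - z j\<bar> \<le> L2_set (\<lambda>i. \<bar>x i - z i\<bar>) {..<n}"
      using that by (intro member_le_L2_set) auto
    also have "\<dots> = l2_dist n x z" by (simp add: l2_dist_def L2_set_def)
    finally show ?thesis using assms by simp
  qed
  have r: "r \<ge> 0" using assms(3) by (rule order_trans[rotated]) (simp add: l2_dist_def)
  have "\<bar>mat_vec m n A x i - mat_vec m n A z i\<bar> = \<bar>\<Sum>j<n. A (i, j) * (x j - z j)\<bar>"
    using assms by (simp add: mat_vec_def algebra_simps sum_subtractf)
  also have "\<dots> \<le> (\<Sum>j<n. \<bar>A (i, j)\<bar> * r)"
    by (rule order_trans[OF sum_abs]) (auto simp: abs_mult intro!: sum_mono mult_left_mono xz)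
  also have "\<dots> = (\<Sum>j<n. \<bar>A (i, j)\<bar>) * r" by (simp add: sum_distrib_right)
  also have "\<dots> \<le> mat_norm_inf m n A * r"
    using assms r unfolding mat_norm_inf_def by (intro mult_right_mono Max_ge) auto
  finally show ?thesis .
qed

text \<open>
  The variance is inflated by \<open>1 + S\<close>, so that shifting the mean by a vector with entries of size
  \<open>\<sigma> sqrt (S / m)\<close> costs only a polynomial factor in \<open>1 + S\<close> per coordinate.
\<close>

definition reference_law :: "nat \<Rightarrow> nat \<Rightarrow> real \<Rightarrow> real \<Rightarrow> rmat \<Rightarrow> rvec \<Rightarrow> rvec measure" where
  "reference_law m n \<sigma> S A z =
    PiM {..<m} (\<lambda>i. density lborel (normal_density (mat_vec m n A z i) (\<sigma> / sqrt (real m) * sqrt (1 + S))))"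

text \<open>The law of \<open>A x + \<xi>\<close> has a product density against the reference law,
  so its second moment splits into \<open>m\<close> one-dimensional ones, each at most
  \<open>(1 + S)\<^sup>2\<close>. The reference involves only the centre \<open>z\<close>, hence the
  same bound serves every \<open>x\<close> in the ball. In the application \<open>f y\<close> is the
  probability that the output on \<open>y\<close> lands near \<open>x\<close>.\<close>

lemma nn_integral_reference_law_ge:
  fixes m n :: nat and r \<sigma> :: real and A :: rmat
  defines "S \<equiv> real m * r\<^sup>2 * (mat_norm_inf m n A)\<^sup>2 / \<sigma>\<^sup>2"
  assumes m: "m \<ge> 1" and \<sigma>: "\<sigma> > 0" and A[measurable]: "A \<in> space (mat_space m n)"
    and x[measurable]: "x \<in> space (vec_space n)" and xz: "l2_dist n x z \<le> r"
    and f[measurable]: "f \<in> borel_measurable (vec_space m)" and f1: "\<And>y. y \<in> space (vec_space m) \<Longrightarrow> f y \<le> 1"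
    and half: "(\<integral>\<^sup>+\<xi>. f (vec_add m (mat_vec m n A x) \<xi>) \<partial>noise m \<sigma>) \<ge> ennreal (1 / 2)"
  shows "(\<integral>\<^sup>+y. f y \<partial>reference_law m n \<sigma> S A z) \<ge> ennreal (1 / (4 * (1 + S) ^ (2 * m)))"
proof -
  let ?\<tau> = "\<sigma> / sqrt (real m)"
  let ?s = "?\<tau> * sqrt (1 + S)"
  let ?\<mu> = "mat_vec m n A x" and ?\<zeta> = "mat_vec m n A z"
  let ?N = "\<lambda>i. density lborel (normal_density (?\<zeta> i) ?s)"
  let ?g = "\<lambda>i t. normal_density (?\<mu> i) ?\<tau> t / normal_density (?\<zeta> i) ?s t"
  have \<mu>: "?\<mu> \<in> space (vec_space m)"
    by (auto simp: mat_vec_def vec_space_def space_PiM PiE_def extensional_def)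
  have S: "S \<ge> 0" unfolding S_def by (auto intro!: divide_nonneg_nonneg)
  have \<tau>: "?\<tau> > 0" using m \<sigma> by simp
  have s: "?s > 0" using \<tau> S by (intro mult_pos_pos) auto
  have sets[measurable_cong]: "sets (reference_law m n \<sigma> S A z) = sets (vec_space m)"
    unfolding reference_law_def vec_space_def by (auto intro!: sets_PiM_cong)
  have dens: "density (?N i) (\<lambda>t. ennreal (?g i t)) = density lborel (normal_density (?\<mu> i) ?\<tau>)" for i
  proof -
    have "normal_density (?\<zeta> i) ?s t * ?g i t = normal_density (?\<mu> i) ?\<tau> t" for t
      using normal_density_pos[OF s, of "?\<zeta> i" t] by simp
    then show ?thesis
      by (subst density_density_eq) (auto simp: ennreal_mult'[symmetric])
  qed
  have shifted: "density (reference_law m n \<sigma> S A z) (\<lambda>y. ennreal (\<Prod>i<m. ?g i (y i)))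
      = distr (noise m \<sigma>) (vec_space m) (vec_add m ?\<mu>)"
  proof -
    have "density (reference_law m n \<sigma> S A z) (\<lambda>y. \<Prod>i<m. ennreal (?g i (y i)))
       = PiM {..<m} (\<lambda>i. density (?N i) (\<lambda>t. ennreal (?g i t)))"
      unfolding reference_law_def
    proof (rule density_PiM_prod)
      show "prob_space (density (?N i) (\<lambda>t. ennreal (?g i t)))" for i
        unfolding dens by (rule prob_space_normal_density[OF \<tau>])
    qed (use s in \<open>auto intro: prob_space_normal_density\<close>)
    also have "\<dots> = distr (noise m \<sigma>) (vec_space m) (vec_add m ?\<mu>)"
      unfolding dens by (rule distr_noise_vec_add[symmetric, OF m \<sigma> \<mu>])
    also have "(\<lambda>y. \<Prod>i<m. ennreal (?g i (y i))) = (\<lambda>y. ennreal (\<Prod>i<m. ?g i (y i)))"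
      by (intro ext prod_ennreal divide_nonneg_nonneg) auto
    finally show ?thesis .
  qed
  interpret product_sigma_finite ?N
    by (rule product_sigma_finite.intro) (rule prob_space_imp_sigma_finite[OF prob_space_normal_density[OF s]])
  have noise_sets[measurable_cong]: "sets (noise m \<sigma>) = sets (vec_space m)"
    using noise_in_prob_algebra[OF m \<sigma>] by (simp add: space_prob_algebra)
  show ?thesis
  proof (rule nn_integral_change_of_measure_ge[where g="\<lambda>y. \<Prod>i<m. ?g i (y i)"])
    show "(\<lambda>y. \<Prod>i<m. ?g i (y i)) \<in> borel_measurable (reference_law m n \<sigma> S A z)"
      unfolding reference_law_def by measurable
    show "f \<in> borel_measurable (reference_law m n \<sigma> S A z)" by measurable
    show "(\<Prod>i<m. ?g i (y i)) \<ge> 0" for y by (intro prod_nonneg divide_nonneg_nonneg) auto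
    show "(1 + S) ^ (2 * m) > 0" using S by simp
    have "(\<integral>\<^sup>+y. ennreal ((\<Prod>i<m. ?g i (y i))\<^sup>2) \<partial>reference_law m n \<sigma> S A z)
       = (\<integral>\<^sup>+y. (\<Prod>i<m. ennreal ((?g i (y i))\<^sup>2)) \<partial>PiM {..<m} ?N)"
      unfolding reference_law_def by (simp add: prod_power_distrib prod_ennreal)
    also have "\<dots> = (\<Prod>i<m. \<integral>\<^sup>+t. ennreal ((?g i t)\<^sup>2) \<partial>?N i)"
      by (rule product_nn_integral_prod) auto
    also have "\<dots> \<le> (\<Prod>i<m. ennreal ((1 + S)\<^sup>2))"
    proof (rule prod_mono_ennreal)
      fix i assume i: "i \<in> {..<m}"
      have "(?\<mu> i - ?\<zeta> i)\<^sup>2 \<le> (mat_norm_inf m n A * r)\<^sup>2"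
        using mat_vec_diff_le[OF m _ xz, of i A] i by (metis abs_ge_zero lessThan_iff power2_abs power_mono)
      \<comment> \<open>\<open>S\<close> is the square of the largest possible shift of a mean,
        \<open>mat_norm_inf m n A * r\<close>, in units of the noise deviation of one
        coordinate.\<close>
      also have "\<dots> = S * ?\<tau>\<^sup>2"
        using m \<sigma> by (simp add: S_def power_mult_distrib power_divide)
      finally show "(\<integral>\<^sup>+t. ennreal ((?g i t)\<^sup>2) \<partial>?N i) \<le> ennreal ((1 + S)\<^sup>2)"
        by (rule nn_integral_normal_density_sq_ratio_le[OF \<tau> S])
    qed
    also have "\<dots> = ennreal ((1 + S) ^ (2 * m))"
      using S by (simp add: ennreal_power power_mult)
    finally show "(\<integral>\<^sup>+y. ennreal ((\<Prod>i<m. ?g i (y i))\<^sup>2) \<partial>reference_law m n \<sigma> S A z) \<le> ennreal ((1 + S) ^ (2 * m))" .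
    show "(\<integral>\<^sup>+y. f y \<partial>density (reference_law m n \<sigma> S A z) (\<lambda>y. ennreal (\<Prod>i<m. ?g i (y i)))) \<ge> ennreal (1 / 2)"
    proof -
      have "vec_add m ?\<mu> \<in> noise m \<sigma> \<rightarrow>\<^sub>M vec_space m"
        using \<mu> by measurable
      moreover have "f \<in> borel_measurable (distr (noise m \<sigma>) (vec_space m) (vec_add m ?\<mu>))"
        by measurable
      ultimately show ?thesis
        unfolding shifted using half by (simp only: nn_integral_distr)
    qed
  qed (use f1 sets_eq_imp_space_eq[OF sets] in auto)
qed

section \<open>Signals with little prior mass nearby\<close>

lemma l2_dist_commute: "l2_dist n u v = l2_dist n v u"
  by (simp add: l2_dist_def L2_set_def power2_commute)

lemma l2_dist_triangle: "l2_dist n u w \<le> l2_dist n u v + l2_dist n v w"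
  using L2_set_triangle_ineq[of "\<lambda>i. u i - v i" "\<lambda>i. v i - w i" "{..<n}"]
  by (simp add: l2_dist_def)

definition l2_ball :: "nat \<Rightarrow> rvec \<Rightarrow> real \<Rightarrow> rvec set" where
  "l2_ball n u t = {x \<in> space (vec_space n). l2_dist n u x \<le> t}"

lemma l2_ball_sets [measurable]:
  assumes [measurable]: "u \<in> space (vec_space n)"
  shows "l2_ball n u t \<in> sets (vec_space n)"
  unfolding l2_ball_def by measurable

lemma l2_ball_subset:
  assumes "l2_dist n v u + s \<le> t"
  shows "l2_ball n u s \<subseteq> l2_ball n v t"
proof
  fix x assume "x \<in> l2_ball n u s"
  then show "x \<in> l2_ball n v t"
    using assms l2_dist_triangle[of n v x u] by (simp add: l2_ball_def)
qed

lemma measurable_emeasure_l2_ball [measurable]: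
  assumes "P \<in> space (prob_algebra (vec_space n))"
  shows "(\<lambda>u. emeasure P (l2_ball n u t)) \<in> borel_measurable (vec_space n)"
proof -
  have sP[measurable_cong]: "sets P = sets (vec_space n)" using assms by (simp add: space_prob_algebra)
  interpret prob_space P using assms by (simp add: space_prob_algebra)
  have "(\<lambda>u. emeasure P (Pair u -` {p \<in> space (vec_space n \<Otimes>\<^sub>M P). l2_dist n (fst p) (snd p) \<le> t}))
      \<in> borel_measurable (vec_space n)"
    by (rule measurable_emeasure_Pair) measurable
  then show ?thesis
    by (rule measurable_cong[THEN iffD1, rotated])
       (auto simp: l2_ball_def space_pair_measure sets_eq_imp_space_eq[OF sP] intro!: arg_cong[where f="emeasure P"])
qed

text \<open>
  Replaces a covering-number argument: averaging over \<open>w \<sim> \<nu>\<close>, a point of small \<open>P\<close>-mass near \<open>w\<close>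
  makes the whole ball around \<open>w\<close> light.
\<close>

lemma emeasure_light_points_le:
  fixes \<kappa> \<epsilon> :: ennreal
  assumes P: "P \<in> space (prob_algebra (vec_space n))" and \<nu>: "\<nu> \<in> space (prob_algebra (vec_space n))"
  shows "\<kappa> * emeasure P {v \<in> space (vec_space n). emeasure P (l2_ball n v (2 * t)) < \<epsilon> \<and>
    \<kappa> \<le> emeasure \<nu> (l2_ball n v t)} \<le> \<epsilon>"
    (is "\<kappa> * emeasure P ?H \<le> \<epsilon>")
proof -
  let ?V = "vec_space n"
  have sP[measurable_cong]: "sets P = sets ?V" using P by (simp add: space_prob_algebra)
  have s\<nu>[measurable_cong]: "sets \<nu> = sets ?V" using \<nu> by (simp add: space_prob_algebra)
  note sp = sets_eq_imp_space_eq[OF sP] sets_eq_imp_space_eq[OF s\<nu>]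
  interpret P: prob_space P using P by (simp add: space_prob_algebra)
  interpret \<nu>: prob_space \<nu> using \<nu> by (simp add: space_prob_algebra)
  interpret pair_sigma_finite \<nu> P ..
  note [measurable] = measurable_emeasure_l2_ball[OF P] measurable_emeasure_l2_ball[OF \<nu>]
  define H where "H = ?H"
  have H[measurable]: "H \<in> sets ?V" unfolding H_def by measurable
  have ball[measurable]: "(\<lambda>(w, v). indicator (l2_ball n v t) w :: ennreal) \<in> borel_measurable (\<nu> \<Otimes>\<^sub>M P)"
  proof -
    have "(\<lambda>q. indicator {q \<in> space (\<nu> \<Otimes>\<^sub>M P). l2_dist n (snd q) (fst q) \<le> t} q :: ennreal)
        \<in> borel_measurable (\<nu> \<Otimes>\<^sub>M P)"
      by measurable
    then show ?thesis
      by (rule measurable_cong[THEN iffD1, rotated])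
         (auto simp: l2_ball_def space_pair_measure sp split: split_indicator)
  qed
  have "\<kappa> * emeasure P H = (\<integral>\<^sup>+v. \<kappa> * indicator H v \<partial>P)"
    by (simp add: nn_integral_cmult)
  also have "\<dots> \<le> (\<integral>\<^sup>+v. (\<integral>\<^sup>+w. indicator H v * indicator (l2_ball n v t) w \<partial>\<nu>) \<partial>P)"
  proof (rule nn_integral_mono)
    fix v assume "v \<in> space P"
    then have [measurable]: "v \<in> space ?V" by (simp add: sp)
    have "(\<integral>\<^sup>+w. indicator H v * indicator (l2_ball n v t) w \<partial>\<nu>) = indicator H v * emeasure \<nu> (l2_ball n v t)"
      by (subst nn_integral_cmult) auto
    then show "\<kappa> * indicator H v \<le> (\<integral>\<^sup>+w. indicator H v * indicator (l2_ball n v t) w \<partial>\<nu>)"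
      by (auto simp: H_def split: split_indicator)
  qed
  also have "\<dots> = (\<integral>\<^sup>+w. (\<integral>\<^sup>+v. indicator H v * indicator (l2_ball n v t) w \<partial>P) \<partial>\<nu>)"
    by (rule Fubini') (use ball in \<open>simp add: case_prod_unfold\<close>)
  also have "\<dots> \<le> (\<integral>\<^sup>+w. \<epsilon> \<partial>\<nu>)"
  proof (rule nn_integral_mono)
    fix w assume "w \<in> space \<nu>"
    then have w[measurable]: "w \<in> space ?V" by (simp add: sp)
    \<comment> \<open>Any two points of \<open>H\<close> within \<open>t\<close> of \<open>w\<close>
      are within \<open>2 * t\<close> of each other; this is the radius at which points of
      \<open>H\<close> are light.\<close>
    show "(\<integral>\<^sup>+v. indicator H v * indicator (l2_ball n v t) w \<partial>P) \<le> \<epsilon>"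
    proof (cases "\<exists>v0\<in>H. l2_dist n v0 w \<le> t")
      case True
      then obtain v0 where v0: "v0 \<in> H" "l2_dist n v0 w \<le> t" by blast
      then have [measurable]: "v0 \<in> space ?V" by (simp add: H_def)
      have "(\<integral>\<^sup>+v. indicator H v * indicator (l2_ball n v t) w \<partial>P)
        \<le> (\<integral>\<^sup>+v. indicator (l2_ball n v0 (2 * t)) v \<partial>P)"
      proof (rule nn_integral_mono)
        fix v assume "v \<in> space P"
        moreover have "l2_dist n v0 v \<le> 2 * t" if "l2_dist n v w \<le> t"
          using that v0(2) l2_dist_triangle[of n v0 v w] l2_dist_commute[of n v w] by linarith
        ultimately show "indicator H v * indicator (l2_ball n v t) w \<le> (indicator (l2_ball n v0 (2 * t)) v :: ennreal)"
          by (auto simp: l2_ball_def sp split: split_indicator)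
      qed
      also have "\<dots> = emeasure P (l2_ball n v0 (2 * t))" by simp
      also have "\<dots> \<le> \<epsilon>" using v0(1) by (auto simp: H_def)
      finally show ?thesis .
    next
      case False
      then have "(\<integral>\<^sup>+v. indicator H v * indicator (l2_ball n v t) w \<partial>P) = (\<integral>\<^sup>+v. 0 \<partial>P)"
        by (intro nn_integral_cong) (auto simp: l2_ball_def split: split_indicator)
      then show ?thesis by simp
    qed
  qed
  also have "\<dots> = \<epsilon>" by (simp add: \<nu>.emeasure_space_1)
  finally show ?thesis unfolding H_def .
qed

text \<open>The preceding estimate counts light points under \<open>P\<close> itself, but signals
  follow \<open>R\<close>; a coupled pair \<open>(u, v)\<close> transfers it. If \<open>u\<close>
  has little \<open>P\<close>-mass nearby, then \<open>u\<close> is light for \<open>\<nu>\<close>,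
  or the pair is more than \<open>\<sigma>\<close> apart, or \<open>v\<close> is light for
  \<open>P\<close> though heavy for \<open>\<nu>\<close>. These three events have mass at most
  \<open>2 * \<delta>\<close>, \<open>\<delta>\<close> and \<open>\<delta>\<close>.\<close>

lemma emeasure_isolated_signals_le:
  fixes \<kappa> \<delta> \<eta> \<sigma> :: real
  assumes R: "R \<in> space (prob_algebra (vec_space n))" and P: "P \<in> space (prob_algebra (vec_space n))"
    and \<nu>: "\<nu> \<in> space (prob_algebra (vec_space n))"
    and \<gamma>: "\<gamma> \<in> couplings n R P"
    and close: "emeasure \<gamma> {p \<in> space \<gamma>. \<sigma> < l2_dist n (fst p) (snd p)} \<le> ennreal \<delta>"
    and \<kappa>: "\<kappa> > 0" and \<delta>: "\<delta> > 0"
    and bad: "emeasure R {u \<in> space (vec_space n). emeasure \<nu> (l2_ball n u \<eta>) < ennreal \<kappa>} \<le> ennreal (2 * \<delta>)"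
  shows "emeasure R {u \<in> space (vec_space n). emeasure P (l2_ball n u (2 * \<eta> + 3 * \<sigma>)) < ennreal (\<kappa> * \<delta>)}
    \<le> ennreal (4 * \<delta>)"
    (is "emeasure R ?I \<le> _")
proof -
  let ?V = "vec_space n"
  have s\<gamma>[measurable_cong]: "sets \<gamma> = sets (?V \<Otimes>\<^sub>M ?V)"
    and fst: "distr \<gamma> ?V fst = R" and snd: "distr \<gamma> ?V snd = P"
    using \<gamma> by (auto simp: couplings_def)
  have sp: "space \<gamma> = space ?V \<times> space ?V"
    using sets_eq_imp_space_eq[OF s\<gamma>] by (simp add: space_pair_measure)
  note [measurable] = measurable_emeasure_l2_ball[OF P] measurable_emeasure_l2_ball[OF \<nu>]
  define H where "H = {v \<in> space ?V. emeasure P (l2_ball n v (2 * (\<eta> + \<sigma>))) < ennreal (\<kappa> * \<delta>) \<and>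
    ennreal \<kappa> \<le> emeasure \<nu> (l2_ball n v (\<eta> + \<sigma>))}"
  have H[measurable]: "H \<in> sets ?V" unfolding H_def by measurable
  define G where "G = {u \<in> space ?V. emeasure \<nu> (l2_ball n u \<eta>) < ennreal \<kappa>}"
  have G[measurable]: "G \<in> sets ?V" unfolding G_def by measurable
  have I[measurable]: "?I \<in> sets ?V" by measurable
  have PH: "emeasure P H \<le> ennreal \<delta>"
  proof -
    have "ennreal \<kappa> * emeasure P H \<le> ennreal \<kappa> * ennreal \<delta>"
      using emeasure_light_points_le[OF P \<nu>, of "ennreal \<kappa>" "\<eta> + \<sigma>" "ennreal (\<kappa> * \<delta>)"] \<kappa>
      by (simp add: H_def ennreal_mult')
    then show ?thesis
      using \<kappa> by (subst (asm) ennreal_mult_le_mult_iff) auto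
  qed
  have pre: "emeasure R X = emeasure \<gamma> (fst -` X \<inter> space \<gamma>)"
    "emeasure P X = emeasure \<gamma> (snd -` X \<inter> space \<gamma>)" if "X \<in> sets ?V" for X
    using that by (simp_all add: fst[symmetric] snd[symmetric] emeasure_distr del: vimage_Int)
  let ?F = "{p \<in> space \<gamma>. \<sigma> < l2_dist n (fst p) (snd p)}"
  have F: "?F \<in> sets \<gamma>" by measurable
  have GS: "fst -` G \<inter> space \<gamma> \<in> sets \<gamma>" and HS: "snd -` H \<inter> space \<gamma> \<in> sets \<gamma>"
    by measurable
  have "emeasure R ?I = emeasure \<gamma> (fst -` ?I \<inter> space \<gamma>)" by (rule pre(1)[OF I])
  also have "\<dots> \<le> emeasure \<gamma> ((fst -` G \<inter> space \<gamma> \<union> ?F) \<union> (snd -` H \<inter> space \<gamma>))"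
  proof (rule emeasure_mono)
    show "fst -` ?I \<inter> space \<gamma> \<subseteq> (fst -` G \<inter> space \<gamma> \<union> ?F) \<union> (snd -` H \<inter> space \<gamma>)"
    proof
      fix p assume p: "p \<in> fst -` ?I \<inter> space \<gamma>"
      obtain u v where uv: "p = (u, v)" by (cases p)
      have u: "u \<in> space ?V" and v: "v \<in> space ?V" using p by (auto simp: uv sp)
      have "v \<in> H" if "u \<notin> G" "l2_dist n u v \<le> \<sigma>"
        unfolding H_def
      proof (intro CollectI conjI v)
        \<comment> \<open>The radius \<open>2 * \<eta> + 3 * \<sigma>\<close> arises here: passing
          from \<open>u\<close> to \<open>v\<close> makes \<open>\<eta>\<close> into
          \<open>\<eta> + \<sigma>\<close>, the light-point estimate doubles it, and moving the
          centre back to \<open>u\<close> adds one more \<open>\<sigma>\<close>.\<close>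
        have "emeasure P (l2_ball n v (2 * (\<eta> + \<sigma>))) \<le> emeasure P (l2_ball n u (2 * \<eta> + 3 * \<sigma>))"
          using that u P by (intro emeasure_mono l2_ball_subset) (auto simp: space_prob_algebra)
        also have "\<dots> < ennreal (\<kappa> * \<delta>)" using p by (auto simp: uv)
        finally show "emeasure P (l2_ball n v (2 * (\<eta> + \<sigma>))) < ennreal (\<kappa> * \<delta>)" .
        have "ennreal \<kappa> \<le> emeasure \<nu> (l2_ball n u \<eta>)" using that u by (auto simp: G_def not_less)
        also have "\<dots> \<le> emeasure \<nu> (l2_ball n v (\<eta> + \<sigma>))"
          using that v \<nu> by (intro emeasure_mono l2_ball_subset) (auto simp: space_prob_algebra l2_dist_commute)
        finally show "ennreal \<kappa> \<le> emeasure \<nu> (l2_ball n v (\<eta> + \<sigma>))" .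
      qed
      then show "p \<in> (fst -` G \<inter> space \<gamma> \<union> ?F) \<union> (snd -` H \<inter> space \<gamma>)"
        using u v by (cases "l2_dist n u v \<le> \<sigma>") (auto simp: uv sp)
    qed
  qed (use F GS HS in auto)
  also have "\<dots> \<le> emeasure \<gamma> (fst -` G \<inter> space \<gamma> \<union> ?F) + emeasure \<gamma> (snd -` H \<inter> space \<gamma>)"
    using F GS HS by (intro emeasure_subadditive) auto
  also have "\<dots> \<le> (emeasure \<gamma> (fst -` G \<inter> space \<gamma>) + emeasure \<gamma> ?F) + emeasure \<gamma> (snd -` H \<inter> space \<gamma>)"
    using F GS by (intro add_right_mono emeasure_subadditive) auto
  also have "\<dots> = (emeasure R G + emeasure \<gamma> ?F) + emeasure P H"
    by (simp only: pre[OF G] pre[OF H])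
  also have "\<dots> \<le> (ennreal (2 * \<delta>) + ennreal \<delta>) + ennreal \<delta>"
    using bad close PH by (intro add_mono) (auto simp: G_def)
  also have "\<dots> = ennreal (4 * \<delta>)"
    using \<delta> by (simp add: ennreal_plus[symmetric] del: ennreal_plus)
  finally show ?thesis .
qed

text \<open>The infimum need not be attained, and the factor \<open>1 / 2\<close> supplies the
  strict gap that yields an actual coupling of cost below
  \<open>\<sigma> * \<delta> powr (1 / p)\<close>. Markov's inequality for the \<open>p\<close>-th
  power of the distance then gives \<open>\<delta>\<close>, whatever \<open>p\<close> is.\<close>

lemma coupling_of_wasserstein:
  fixes p \<sigma> \<delta> :: real
  assumes p: "p \<ge> 1" and \<sigma>: "\<sigma> > 0" and \<delta>: "\<delta> > 0"
    and W: "wasserstein n p R P \<le> ennreal (1 / 2 * \<sigma> * \<delta> powr (1 / p))"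
  obtains \<gamma> where "\<gamma> \<in> couplings n R P"
    "emeasure \<gamma> {q \<in> space \<gamma>. \<sigma> < l2_dist n (fst q) (snd q)} \<le> ennreal \<delta>"
proof -
  define t where "t = \<sigma> * \<delta> powr (1 / p)"
  have t: "t > 0" using \<sigma> \<delta> by (simp add: t_def)
  have "wasserstein n p R P < ennreal t"
    by (rule le_less_trans[OF W]) (use t in \<open>simp add: t_def ennreal_less_iff\<close>)
  then obtain \<gamma> where \<gamma>: "\<gamma> \<in> couplings n R P"
    and less: "ennreal_root p (\<integral>\<^sup>+ (u, v). ennreal (l2_dist n u v powr p) \<partial>\<gamma>) < ennreal t"
    unfolding wasserstein_def INF_less_iff by blast
  let ?a = "\<integral>\<^sup>+ q. ennreal (l2_dist n (fst q) (snd q) powr p) \<partial>\<gamma>"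
  have s\<gamma>[measurable_cong]: "sets \<gamma> = sets (vec_space n \<Otimes>\<^sub>M vec_space n)"
    using \<gamma> by (simp add: couplings_def)
  have a: "ennreal_root p ?a < ennreal t"
    using less by (simp add: case_prod_unfold)
  \<comment> \<open>\<open>ennreal_root\<close> keeps infinity infinite, so a root below
    \<open>t\<close> forces a finite moment, and \<open>enn2real\<close> loses nothing.\<close>
  then have fin: "?a \<noteq> \<top>" by (auto simp: ennreal_root_def)
  define b where "b = enn2real ?a"
  have ab: "?a = ennreal b" using fin by (simp add: b_def less_top)
  have b0: "b \<ge> 0" by (simp add: b_def)
  have "b powr (1 / p) < t"
    using a fin t by (auto simp: ennreal_root_def b_def ennreal_less_iff split: if_splits)
  then have "(b powr (1 / p)) powr p \<le> t powr p"
    using p by (intro powr_mono2) auto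
  then have bt: "b \<le> \<sigma> powr p * \<delta>"
    using p b0 \<sigma> \<delta> by (simp add: powr_powr t_def powr_mult)
  have "ennreal (\<sigma> powr p) * emeasure \<gamma> {q \<in> space \<gamma>. \<sigma> < l2_dist n (fst q) (snd q)}
      = (\<integral>\<^sup>+q. ennreal (\<sigma> powr p) * indicator {q \<in> space \<gamma>. \<sigma> < l2_dist n (fst q) (snd q)} q \<partial>\<gamma>)"
    by (simp add: nn_integral_cmult)
  also have "\<dots> \<le> ?a"
    using p \<sigma> by (intro nn_integral_mono) (auto split: split_indicator intro!: ennreal_leI powr_mono2)
  also have "\<dots> \<le> ennreal (\<sigma> powr p) * ennreal \<delta>"
    unfolding ab using bt \<delta> by (simp add: ennreal_mult'[symmetric] ennreal_leI)
  finally have "emeasure \<gamma> {q \<in> space \<gamma>. \<sigma> < l2_dist n (fst q) (snd q)} \<le> ennreal \<delta>"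
    using \<sigma> by (subst (asm) ennreal_mult_le_mult_iff) auto
  with \<gamma> show thesis by (rule that)
qed

text \<open>Posterior sampling with respect to \<open>R\<close> is the case \<open>P = R\<close>
  without transport cost; this coupling lets one argument serve both conclusions.\<close>

lemma diagonal_coupling:
  assumes R: "R \<in> space (prob_algebra (vec_space n))" and \<sigma>: "\<sigma> > 0"
  obtains \<gamma> where "\<gamma> \<in> couplings n R R"
    "emeasure \<gamma> {q \<in> space \<gamma>. \<sigma> < l2_dist n (fst q) (snd q)} = 0"
proof
  let ?V = "vec_space n"
  let ?\<gamma> = "distr R (?V \<Otimes>\<^sub>M ?V) (\<lambda>x. (x, x))"
  have sR[measurable_cong]: "sets R = sets ?V" using R by (simp add: space_prob_algebra)
  show "?\<gamma> \<in> couplings n R R"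
    by (simp add: couplings_def distr_distr comp_def distr_id2 sR)
  have "{q \<in> space ?\<gamma>. \<sigma> < l2_dist n (fst q) (snd q)} \<in> sets ?\<gamma>" by measurable
  then have "emeasure ?\<gamma> {q \<in> space ?\<gamma>. \<sigma> < l2_dist n (fst q) (snd q)}
      = emeasure R ((\<lambda>x. (x, x)) -` {q \<in> space ?\<gamma>. \<sigma> < l2_dist n (fst q) (snd q)} \<inter> space R)"
    by (intro emeasure_distr) auto
  also have "(\<lambda>x. (x, x)) -` {q \<in> space ?\<gamma>. \<sigma> < l2_dist n (fst q) (snd q)} \<inter> space R = {}"
    using \<sigma> by (auto simp: l2_dist_def L2_set_def)
  finally show "emeasure ?\<gamma> {q \<in> space ?\<gamma>. \<sigma> < l2_dist n (fst q) (snd q)} = 0" by simp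
qed

section \<open>Success probabilities and the output on a reference observation\<close>

lemma recovery_law_in_prob_algebra:
  assumes "m \<ge> 1" "\<sigma> > 0" "R \<in> space (prob_algebra (vec_space n))" "S \<in> algorithms m n"
    "A \<in> space (mat_space m n)"
  shows "recovery_law m n \<sigma> R A S \<in> space (prob_algebra (vec_space n \<Otimes>\<^sub>M vec_space n))"
  by (rule measurable_space[OF recovery_law_measurable[OF assms(1-4)] assms(5)])

lemma prob_Compl_event:
  fixes Q :: "'a \<Rightarrow> 'b \<Rightarrow> bool"
  assumes L: "L \<in> space (prob_algebra (M \<Otimes>\<^sub>M N))"
    and [measurable]: "Measurable.pred (M \<Otimes>\<^sub>M N) (\<lambda>(x, y). Q x y)"
  shows "emeasure L {p \<in> space (M \<Otimes>\<^sub>M N). case p of (x, y) \<Rightarrow> \<not> Q x y} = ennreal (1 - \<P>((x, y) in L. Q x y))"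
proof -
  interpret prob_space L using L by (simp add: space_prob_algebra)
  have sL[measurable_cong]: "sets L = sets (M \<Otimes>\<^sub>M N)" using L by (simp add: space_prob_algebra)
  have "{p \<in> space L. case p of (x, y) \<Rightarrow> Q x y} \<in> sets L" by measurable
  then have "prob (space L - {p \<in> space L. case p of (x, y) \<Rightarrow> Q x y})
      = 1 - prob {p \<in> space L. case p of (x, y) \<Rightarrow> Q x y}"
    by (rule prob_compl)
  moreover have "{p \<in> space L. case p of (x, y) \<Rightarrow> Q x y} = {(x, y). (x, y) \<in> space L \<and> Q x y}"
    by auto
  moreover have "space L - {p \<in> space L. case p of (x, y) \<Rightarrow> Q x y}
      = {p \<in> space (M \<Otimes>\<^sub>M N). case p of (x, y) \<Rightarrow> \<not> Q x y}"
    by (auto simp: sets_eq_imp_space_eq[OF sL])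
  ultimately show ?thesis by (simp add: emeasure_eq_measure)
qed

lemma algorithm_in_prob_algebra:
  assumes "S \<in> algorithms m n" "y \<in> space (vec_space m)" "A \<in> space (mat_space m n)"
  shows "S (y, A) \<in> space (prob_algebra (vec_space n))"
  by (rule measurable_space[OF assms(1)[unfolded algorithms_def]]) (simp add: space_pair_measure assms)

lemma vec_add_in_space: "vec_add m u v \<in> space (vec_space m)"
  by (simp add: vec_space_def vec_add_def space_PiM)

text \<open>
  \<open>\<nu>\<close> is the law of the output of the algorithm on an observation that is independent of the signal.
\<close>

lemma algorithm_reference_output:
  fixes m n :: nat and r \<sigma> \<delta> K :: real and A :: rmat
  defines "\<kappa> \<equiv> 1 / (4 * (1 + real m * r\<^sup>2 * (mat_norm_inf m n A)\<^sup>2 / \<sigma>\<^sup>2) ^ (2 * m))"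
  assumes m: "m \<ge> 1" and \<sigma>: "\<sigma> > 0" and \<delta>: "\<delta> > 0"
    and R: "R \<in> space (prob_algebra (vec_space n))" and ball: "supported_on_ball n r R"
    and A: "A \<in> space (mat_space m n)" and S: "S \<in> algorithms m n"
    and succ: "\<P>((x, xh) in recovery_law m n \<sigma> R A S. l2_dist n x xh \<le> K * \<sigma>) \<ge> 1 - \<delta>"
  obtains \<nu> where "\<nu> \<in> space (prob_algebra (vec_space n))"
    "emeasure R {u \<in> space (vec_space n). emeasure \<nu> (l2_ball n u (K * \<sigma>)) < ennreal \<kappa>} \<le> ennreal (2 * \<delta>)"
proof -
  let ?V = "vec_space n" and ?N = "noise m \<sigma>"
  define T where "T = real m * r\<^sup>2 * (mat_norm_inf m n A)\<^sup>2 / \<sigma>\<^sup>2"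
  obtain z where z: "z \<in> space ?V" "AE x in R. l2_dist n x z \<le> r"
    using ball by (auto simp: supported_on_ball_def)
  have T: "T \<ge> 0" unfolding T_def by (auto intro!: divide_nonneg_nonneg)
  have sR[measurable_cong]: "sets R = sets ?V" using R by (simp add: space_prob_algebra)
  have sN[measurable_cong]: "sets ?N = sets (vec_space m)"
    using noise_in_prob_algebra[OF m \<sigma>] by (simp add: space_prob_algebra)
  note spR = sets_eq_imp_space_eq[OF sR] and spN = sets_eq_imp_space_eq[OF sN]
  interpret N: prob_space ?N using noise_in_prob_algebra[OF m \<sigma>] by (simp add: space_prob_algebra)
  have SA[measurable]: "(\<lambda>y. S (y, A)) \<in> vec_space m \<rightarrow>\<^sub>M prob_algebra ?V"
  proof -
    have [measurable]: "S \<in> vec_space m \<Otimes>\<^sub>M mat_space m n \<rightarrow>\<^sub>M prob_algebra ?V"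
      using S by (simp add: algorithms_def)
    note [measurable] = A
    show ?thesis by measurable
  qed
  define Q where "Q = reference_law m n \<sigma> T A z"
  have Q: "Q \<in> space (prob_algebra (vec_space m))"
    unfolding Q_def reference_law_def vec_space_def space_prob_algebra
    using m \<sigma> T by (auto intro!: sets_PiM_cong prob_space_PiM_normal mult_pos_pos)
  define \<nu> where "\<nu> = Q \<bind> (\<lambda>y. S (y, A))"
  have \<nu>: "\<nu> \<in> space (prob_algebra ?V)"
    unfolding \<nu>_def using prob_space_bind'[OF Q SA] sets_bind'[OF Q SA] by (simp add: space_prob_algebra)
  have \<nu>_eq: "emeasure \<nu> B = (\<integral>\<^sup>+y. emeasure (S (y, A)) B \<partial>Q)" if "B \<in> sets ?V" for B
    unfolding \<nu>_def by (rule emeasure_bind_prob_algebra[OF Q SA that])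
  let ?y = "\<lambda>x \<xi>. vec_add m (mat_vec m n A x) \<xi>"
  \<comment> \<open>The failure probability of the algorithm given the signal
    \<open>x\<close>.\<close>
  define h where "h = (\<lambda>x. \<integral>\<^sup>+\<xi>. emeasure (S (?y x \<xi>, A)) {xh \<in> space ?V. \<not> l2_dist n x xh \<le> K * \<sigma>} \<partial>?N)"
  have fail: "(\<integral>\<^sup>+x. h x \<partial>R) \<le> ennreal \<delta>"
  proof -
    have "(\<integral>\<^sup>+x. h x \<partial>R) = emeasure (recovery_law m n \<sigma> R A S)
        {p \<in> space (?V \<Otimes>\<^sub>M ?V). case p of (x, xh) \<Rightarrow> \<not> l2_dist n x xh \<le> K * \<sigma>}"
      unfolding h_def by (rule emeasure_recovery_law[symmetric, OF m \<sigma> R S A]) measurable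
    also have "\<dots> = ennreal (1 - \<P>((x, xh) in recovery_law m n \<sigma> R A S. l2_dist n x xh \<le> K * \<sigma>))"
      by (rule prob_Compl_event[OF recovery_law_in_prob_algebra[OF m \<sigma> R S A]]) measurable
    also have "\<dots> \<le> ennreal \<delta>"
      using succ by (intro ennreal_leI) simp
    finally show ?thesis .
  qed
  \<comment> \<open>By contraposition: success at \<open>x\<close> with probability at least
    \<open>1 / 2\<close> would, by the change of measure, give the ball around \<open>x\<close> mass
    at least \<open>\<kappa>\<close> under \<open>\<nu>\<close>. The algorithm therefore fails at
    least half of the time on signals with a light ball.\<close>
  have h_ge: "h x \<ge> ennreal (1 / 2)"
    if x[measurable]: "x \<in> space ?V" and xz: "l2_dist n x z \<le> r"
      and light: "emeasure \<nu> (l2_ball n x (K * \<sigma>)) < ennreal \<kappa>" for x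
  proof -
    let ?B = "l2_ball n x (K * \<sigma>)"
    define g where "g = (\<integral>\<^sup>+\<xi>. emeasure (S (?y x \<xi>, A)) ?B \<partial>?N)"
    have B: "?B \<in> sets ?V" by measurable
    have [measurable]: "(\<lambda>y. emeasure (S (y, A)) X) \<in> borel_measurable (vec_space m)" if "X \<in> sets ?V" for X
      using measurable_emeasure_kernel[OF measurable_prob_algebraD[OF SA] that] .
    have compl: "{xh \<in> space ?V. \<not> l2_dist n x xh \<le> K * \<sigma>} = space ?V - ?B"
      by (auto simp: l2_ball_def)
    have "h x + g = (\<integral>\<^sup>+\<xi>. emeasure (S (?y x \<xi>, A)) (space ?V - ?B) + emeasure (S (?y x \<xi>, A)) ?B \<partial>?N)"
    proof -
      have [measurable]: "mat_vec m n A x \<in> space (vec_space m)"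
        by (auto simp: mat_vec_def vec_space_def space_PiM PiE_def extensional_def)
      have "(\<lambda>\<xi>. emeasure (S (?y x \<xi>, A)) X) \<in> borel_measurable ?N" if [measurable]: "X \<in> sets ?V" for X
        by (rule measurable_compose[of "?y x" _ "vec_space m"]) measurable
      then show ?thesis
        unfolding h_def g_def compl using B by (intro nn_integral_add[symmetric]) auto
    qed
    also have "\<dots> = (\<integral>\<^sup>+\<xi>. 1 \<partial>?N)"
    proof (rule nn_integral_cong)
      fix \<xi>
      let ?L = "S (?y x \<xi>, A)"
      have L: "?L \<in> space (prob_algebra ?V)"
        by (rule algorithm_in_prob_algebra[OF S vec_add_in_space A])
      then have sL: "sets ?L = sets ?V" by (simp add: space_prob_algebra)
      have "emeasure ?L (space ?V - ?B) + emeasure ?L ?B = emeasure ?L ((space ?V - ?B) \<union> ?B)"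
        using B by (intro plus_emeasure) (auto simp: sL)
      also have "(space ?V - ?B) \<union> ?B = space ?V" by (auto simp: l2_ball_def)
      finally show "emeasure ?L (space ?V - ?B) + emeasure ?L ?B = 1"
        using in_space_prob_algebra[OF L] by simp
    qed
    also have "\<dots> = 1" by (simp add: N.emeasure_space_1)
    finally have hg: "h x + g = 1" .
    have "\<not> g \<ge> ennreal (1 / 2)"
    proof
      assume "g \<ge> ennreal (1 / 2)"
      then have "(\<integral>\<^sup>+y. emeasure (S (y, A)) ?B \<partial>Q) \<ge> ennreal \<kappa>"
        unfolding \<kappa>_def Q_def T_def
      proof (intro nn_integral_reference_law_ge[OF m \<sigma> A x xz])
        show "emeasure (S (y, A)) ?B \<le> 1" if "y \<in> space (vec_space m)" for y
          using algorithm_in_prob_algebra[OF S that A]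
          by (simp add: space_prob_algebra prob_space.emeasure_le_1)
      qed (use B in \<open>simp_all add: g_def\<close>)
      then show False using light by (simp add: \<nu>_eq[OF B])
    qed
    then have g: "g < ennreal (1 / 2)" by simp
    show ?thesis
    proof (rule ccontr)
      assume "\<not> h x \<ge> ennreal (1 / 2)"
      then have "h x + g < ennreal (1 / 2) + ennreal (1 / 2)"
        using g by (intro add_strict_mono) auto
      then show False unfolding hg by (simp add: ennreal_plus[symmetric] del: ennreal_plus ennreal_half)
    qed
  qed
  have h_meas: "h \<in> borel_measurable R"
  proof -
    have "(\<lambda>p. emeasure (S (?y (fst p) (snd p), A)) {xh \<in> space ?V. \<not> l2_dist n (fst p) xh \<le> K * \<sigma>})
        \<in> borel_measurable (?V \<Otimes>\<^sub>M vec_space m)"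
    proof (rule emeasure_measurable_subprob_algebra2)
      have "(SIGMA p:space (?V \<Otimes>\<^sub>M vec_space m). {xh \<in> space ?V. \<not> l2_dist n (fst p) xh \<le> K * \<sigma>})
         = {q \<in> space ((?V \<Otimes>\<^sub>M vec_space m) \<Otimes>\<^sub>M ?V). \<not> l2_dist n (fst (fst q)) (snd q) \<le> K * \<sigma>}"
        by (auto simp: space_pair_measure)
      also have "\<dots> \<in> sets ((?V \<Otimes>\<^sub>M vec_space m) \<Otimes>\<^sub>M ?V)" by measurable
      finally show "(SIGMA p:space (?V \<Otimes>\<^sub>M vec_space m). {xh \<in> space ?V. \<not> l2_dist n (fst p) xh \<le> K * \<sigma>})
        \<in> sets ((?V \<Otimes>\<^sub>M vec_space m) \<Otimes>\<^sub>M ?V)" .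
      note [measurable] = A
      show "(\<lambda>p. S (?y (fst p) (snd p), A)) \<in> ?V \<Otimes>\<^sub>M vec_space m \<rightarrow>\<^sub>M subprob_algebra ?V"
        by (rule measurable_compose[OF _ measurable_prob_algebraD[OF SA]]) measurable
    qed
    then have [measurable]: "(\<lambda>(x, \<xi>). emeasure (S (?y x \<xi>, A)) {xh \<in> space ?V. \<not> l2_dist n x xh \<le> K * \<sigma>})
        \<in> borel_measurable (R \<Otimes>\<^sub>M ?N)"
      by (simp add: case_prod_unfold cong: measurable_cong_sets sets_pair_measure_cong[OF sR sN])
    show ?thesis unfolding h_def by measurable
  qed
  show thesis
  proof (rule that[OF \<nu>])
    let ?G = "{u \<in> space ?V. emeasure \<nu> (l2_ball n u (K * \<sigma>)) < ennreal \<kappa>}"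
    note [measurable] = measurable_emeasure_l2_ball[OF \<nu>] h_meas
    \<comment> \<open>The average failure is at most \<open>\<delta>\<close>, so Markov's inequality
      at level \<open>1 / 2\<close> produces \<open>2 * \<delta>\<close>.\<close>
    have "emeasure R ?G \<le> emeasure R {x \<in> space R. 1 \<le> ennreal 2 * h x}"
    proof (rule emeasure_mono_AE)
      show "AE x in R. x \<in> ?G \<longrightarrow> x \<in> {x \<in> space R. 1 \<le> ennreal 2 * h x}"
        using z(2)
      proof eventually_elim
        case (elim x)
        show ?case
        proof (intro impI CollectI conjI)
          assume x: "x \<in> ?G"
          then show "x \<in> space R" by (simp add: spR)
          have "1 = ennreal 2 * ennreal (1 / 2)"
            by (subst ennreal_mult'[symmetric]) auto
          also have "\<dots> \<le> ennreal 2 * h x"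
            using x elim by (intro mult_left_mono h_ge) auto
          finally show "1 \<le> ennreal 2 * h x" .
        qed
      qed
    qed measurable
    also have "\<dots> \<le> ennreal 2 * (\<integral>\<^sup>+x. h x * indicator (space R) x \<partial>R)"
      using nn_integral_Markov_inequality[of h "space R" R "ennreal 2"] h_meas by (simp add: Collect_conj_eq)
    also have "\<dots> \<le> ennreal 2 * ennreal \<delta>"
      using fail by (intro mult_left_mono) (auto cong: nn_integral_cong)
    also have "\<dots> = ennreal (2 * \<delta>)" by (simp add: ennreal_mult')
    finally show "emeasure R ?G \<le> ennreal (2 * \<delta>)" .
  qed
qed

section \<open>Posterior sampling\<close>

text \<open>\<open>b\<close> is chosen so that \<open>\<theta> * b = 2\<close>: the first term is
  then at most \<open>2 * exp (- m')\<close>, even after the factor \<open>sqrt 2 ^ m'\<close>.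
  \<open>C\<close> is chosen so that the far decay is at most \<open>exp (- (b + 2) * m')\<close>:
  the part \<open>b\<close> undoes the threshold, one unit pays for \<open>1 / \<rho>\<close>, and
  the last leaves \<open>exp (- m') \<le> \<delta>\<close>.\<close>

lemma numeric_failure_bound:
  fixes a b C L \<delta> \<rho> :: real and m' :: nat
  assumes "b = 4 * (1 + a\<^sup>2)" "C = exp (b + 2)" and \<delta>: "0 < \<delta>" "\<delta> < 1 / 8" and L: "L \<ge> 0"
    and \<rho>: "\<rho> = \<delta> / (4 * exp (2 * L))" and m': "real m' \<ge> 2 * (L + ln (1 / \<delta>))"
  shows "2 * exp (- (1 / (2 * (1 + a\<^sup>2))) * (b * real m')) * sqrt 2 ^ m' +
    2 / \<rho> * exp (b * real m') * (1 / sqrt (2 + C\<^sup>2)) ^ m' \<le> 4 * \<delta>"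
proof -
  let ?M = "real m'"
  have l\<delta>: "ln (1 / \<delta>) \<ge> 0" using \<delta> by simp
  have e\<delta>: "exp (- ?M) \<le> \<delta>"
  proof -
    have "exp (- ?M) \<le> exp (- ln (1 / \<delta>))" using m' L l\<delta> by simp
    also have "\<dots> = \<delta>" using \<delta> by (simp add: ln_div)
    finally show ?thesis .
  qed
  have "1 + a\<^sup>2 > 0" by (simp add: add_pos_nonneg)
  then have "1 / (2 * (1 + a\<^sup>2)) * b = 2"
    unfolding assms(1) by (simp add: field_simps)
  then have "- (1 / (2 * (1 + a\<^sup>2))) * (b * ?M) = - (2 * ?M)"
    by (simp only: mult.assoc[symmetric] mult_minus_left)
  moreover have "sqrt 2 ^ m' \<le> exp ?M"
  proof -
    have "sqrt 2 \<le> exp 1"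
    proof -
      have "sqrt 2 \<le> 2" by (rule real_le_lsqrt) auto
      also have "(2::real) \<le> exp 1" using exp_ge_add_one_self[of 1] by simp
      finally show ?thesis .
    qed
    then have "sqrt 2 ^ m' \<le> exp 1 ^ m'" by (intro power_mono) auto
    also have "\<dots> = exp ?M" by (simp add: exp_of_nat_mult[symmetric])
    finally show ?thesis .
  qed
  ultimately have "2 * exp (- (1 / (2 * (1 + a\<^sup>2))) * (b * ?M)) * sqrt 2 ^ m' \<le> 2 * exp (- (2 * ?M)) * exp ?M"
    by simp
  also have "\<dots> = 2 * exp (- ?M)" by (simp add: exp_add[symmetric])
  also have "\<dots> \<le> 2 * \<delta>" using e\<delta> by simp
  finally have 1: "2 * exp (- (1 / (2 * (1 + a\<^sup>2))) * (b * ?M)) * sqrt 2 ^ m' \<le> 2 * \<delta>" .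
  have "1 / \<rho> \<le> exp ?M"
  proof -
    \<comment> \<open>The constant \<open>4\<close> in \<open>\<rho>\<close> is absorbed into a
      second factor \<open>1 / \<delta>\<close>, so that twice \<open>L + ln (1 / \<delta>)\<close>
      suffices for \<open>m'\<close>.\<close>
    have "(4::real) \<le> 1 / \<delta>" using \<delta> by (simp add: field_simps)
    then have "1 / \<rho> \<le> (1 / \<delta>) * exp (2 * L) * (1 / \<delta>)"
      unfolding \<rho> using \<delta> by (simp add: field_simps)
    also have "\<dots> = exp (ln (1 / \<delta>) + 2 * L + ln (1 / \<delta>))"
      using \<delta> by (simp only: exp_add exp_ln zero_less_divide_1_iff)
    also have "\<dots> \<le> exp ?M" using m' by simp
    finally show ?thesis .
  qed
  moreover have "(1 / sqrt (2 + C\<^sup>2)) ^ m' \<le> exp (- ((b + 2) * ?M))"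
  proof -
    have C: "C > 0" by (simp add: assms(2))
    have "C = sqrt (C\<^sup>2)" using C by simp
    also have "\<dots> \<le> sqrt (2 + C\<^sup>2)" by (rule real_sqrt_le_mono) simp
    finally have "1 / sqrt (2 + C\<^sup>2) \<le> 1 / C" using C by (intro divide_left_mono) (auto intro!: mult_pos_pos add_pos_nonneg)
    also have "1 / C = exp (- (b + 2))" unfolding assms(2) by (simp only: exp_minus inverse_eq_divide)
    finally have "(1 / sqrt (2 + C\<^sup>2)) ^ m' \<le> exp (- (b + 2)) ^ m'" by (intro power_mono) auto
    also have "\<dots> = exp (- ((b + 2) * ?M))"
      by (simp add: exp_of_nat_mult[symmetric] algebra_simps)
    finally show ?thesis .
  qed
  ultimately have "1 / \<rho> * exp (b * ?M) * (1 / sqrt (2 + C\<^sup>2)) ^ m' \<le> exp ?M * exp (b * ?M) * exp (- ((b + 2) * ?M))"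
    by (intro mult_mono) auto
  also have "\<dots> = exp (- ?M)" by (simp add: exp_add[symmetric] algebra_simps)
  also have "\<dots> \<le> \<delta>" by (rule e\<delta>)
  finally show ?thesis using 1 by simp
qed

text \<open>The law draws the matrix first, whereas the posterior bound concerns a fixed signal with
  noise and matrix averaged; hence the signal is moved to the outermost integral.\<close>

lemma emeasure_gaussian_recovery_failure:
  fixes \<sigma> t :: real
  assumes m: "m \<ge> 1" and \<sigma>: "\<sigma> > 0" and R: "R \<in> space (prob_algebra (vec_space n))"
    and S: "S \<in> algorithms m n"
  shows "emeasure (gaussian_recovery_law m n \<sigma> R S)
      {p \<in> space (vec_space n \<Otimes>\<^sub>M vec_space n). case p of (x, xh) \<Rightarrow> \<not> l2_dist n x xh \<le> t} =
    (\<integral>\<^sup>+u. (\<integral>\<^sup>+\<xi>. (\<integral>\<^sup>+A. emeasure (S (vec_add m (mat_vec m n A u) \<xi>, A))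
      {x \<in> space (vec_space n). \<not> l2_dist n u x \<le> t} \<partial>gaussian_matrix m n) \<partial>noise m \<sigma>) \<partial>R)"
proof -
  let ?V = "vec_space n" and ?N = "noise m \<sigma>" and ?G = "gaussian_matrix m n"
  note N = noise_in_prob_algebra[OF m \<sigma>] and G = gaussian_matrix_in_prob_algebra[OF m, of n]
  have sR: "sets R = sets ?V" using R by (simp add: space_prob_algebra)
  have sN: "sets ?N = sets (vec_space m)" using N by (simp add: space_prob_algebra)
  have sG: "sets ?G = sets (mat_space m n)" using G by (simp add: space_prob_algebra)
  let ?X = "{p \<in> space (?V \<Otimes>\<^sub>M ?V). case p of (x, xh) \<Rightarrow> \<not> l2_dist n x xh \<le> t}"
  have X: "?X \<in> sets (?V \<Otimes>\<^sub>M ?V)" by measurable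
  let ?e = "\<lambda>u \<xi> A. emeasure (S (vec_add m (mat_vec m n A u) \<xi>, A)) {x \<in> space ?V. \<not> l2_dist n u x \<le> t}"
  have "emeasure (gaussian_recovery_law m n \<sigma> R S) ?X = (\<integral>\<^sup>+A. emeasure (recovery_law m n \<sigma> R A S) ?X \<partial>?G)"
    unfolding gaussian_recovery_law_def
    by (rule emeasure_bind_prob_algebra[OF G recovery_law_measurable[OF m \<sigma> R S] X])
  also have "\<dots> = (\<integral>\<^sup>+A. (\<integral>\<^sup>+u. (\<integral>\<^sup>+\<xi>. ?e u \<xi> A \<partial>?N) \<partial>R) \<partial>?G)"
    by (intro nn_integral_cong emeasure_recovery_law[OF m \<sigma> R S])
       (simp add: sets_eq_imp_space_eq[OF sG], measurable)
  also have "\<dots> = (\<integral>\<^sup>+u. (\<integral>\<^sup>+\<xi>. (\<integral>\<^sup>+A. ?e u \<xi> A \<partial>?G) \<partial>?N) \<partial>R)"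
  proof (rule nn_integral_swap3[symmetric])
    let ?W = "?V \<Otimes>\<^sub>M vec_space m \<Otimes>\<^sub>M mat_space m n"
    have [measurable]: "S \<in> vec_space m \<Otimes>\<^sub>M mat_space m n \<rightarrow>\<^sub>M subprob_algebra ?V"
      using S by (simp add: algorithms_def measurable_prob_algebraD)
    have "(\<lambda>p. emeasure (S (vec_add m (mat_vec m n (snd (snd p)) (fst p)) (fst (snd p)), snd (snd p)))
        {x \<in> space ?V. \<not> l2_dist n (fst p) x \<le> t}) \<in> borel_measurable ?W"
    proof (rule emeasure_measurable_subprob_algebra2)
      have "(SIGMA p:space ?W. {x \<in> space ?V. \<not> l2_dist n (fst p) x \<le> t})
        = {q \<in> space (?W \<Otimes>\<^sub>M ?V). \<not> l2_dist n (fst (fst q)) (snd q) \<le> t}"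
        by (auto simp: space_pair_measure)
      also have "\<dots> \<in> sets (?W \<Otimes>\<^sub>M ?V)" by measurable
      finally show "(SIGMA p:space ?W. {x \<in> space ?V. \<not> l2_dist n (fst p) x \<le> t}) \<in> sets (?W \<Otimes>\<^sub>M ?V)" .
    qed measurable
    then show "(\<lambda>(u, \<xi>, A). ?e u \<xi> A) \<in> borel_measurable (R \<Otimes>\<^sub>M ?N \<Otimes>\<^sub>M ?G)"
      by (simp add: case_prod_unfold
          cong: measurable_cong_sets sets_pair_measure_cong[OF sR sets_pair_measure_cong[OF sN sG]])
  qed (use R N G in \<open>auto simp: space_prob_algebra intro: prob_space_imp_sigma_finite\<close>)
  finally show ?thesis .
qed

text \<open>\<open>a * \<sigma>\<close> is the radius \<open>2 * \<eta> + 3 * \<sigma>\<close> for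
  the accuracy \<open>\<eta> = K * \<sigma>\<close> of the given algorithm. The loss
  \<open>8 * \<delta>\<close> consists of \<open>4 * \<delta>\<close> for signals with too little
  \<open>P\<close>-mass within this radius and \<open>4 * \<delta>\<close> for failure of the
  posterior at the others.\<close>

lemma posterior_sampling_success:
  fixes K a b C r \<sigma> \<delta> :: real and n m m' :: nat
  assumes K: "K > 0" and a: "a = 2 * K + 3" and b: "b = 4 * (1 + a\<^sup>2)" and C: "C = exp (b + 2)"
    and m: "m \<ge> 1" and \<sigma>: "\<sigma> > 0" and \<delta>: "0 < \<delta>"
    and R: "R \<in> space (prob_algebra (vec_space n))" and ball: "supported_on_ball n r R"
    and A: "A \<in> space (mat_space m n)" and S: "S \<in> algorithms m n"
    and succ: "\<P>((x, xh) in recovery_law m n \<sigma> R A S. l2_dist n x xh \<le> K * \<sigma>) \<ge> 1 - \<delta>"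
    and m': "m' \<ge> 1"
      "real m' \<ge> 2 * (real m * ln (1 + real m * r\<^sup>2 * (mat_norm_inf m n A)\<^sup>2 / \<sigma>\<^sup>2) + ln (1 / \<delta>))"
    and P: "P \<in> space (prob_algebra (vec_space n))" and \<gamma>: "\<gamma> \<in> couplings n R P"
    and close: "emeasure \<gamma> {p \<in> space \<gamma>. \<sigma> < l2_dist n (fst p) (snd p)} \<le> ennreal \<delta>"
  shows "\<P>((x, xh) in gaussian_recovery_law m' n \<sigma> R (posterior m' n \<sigma> P). l2_dist n x xh \<le> C * \<sigma>)
    \<ge> 1 - 8 * \<delta>"
proof (cases "\<delta> < 1 / 8")
  case False
  \<comment> \<open>For such \<open>\<delta>\<close> the claimed lower bound is nonpositive; the
    main case gains \<open>\<delta> < 1 / 8\<close> for the numerical estimate.\<close>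
  then have "1 - 8 * \<delta> \<le> 0" by simp
  also have "0 \<le> \<P>((x, xh) in gaussian_recovery_law m' n \<sigma> R (posterior m' n \<sigma> P). l2_dist n x xh \<le> C * \<sigma>)"
    by simp
  finally show ?thesis .
next
  case True
  let ?V = "vec_space n"
  define T where "T = real m * r\<^sup>2 * (mat_norm_inf m n A)\<^sup>2 / \<sigma>\<^sup>2"
  have T: "T \<ge> 0" unfolding T_def by (auto intro!: divide_nonneg_nonneg)
  define \<kappa> where "\<kappa> = 1 / (4 * (1 + T) ^ (2 * m))"
  have \<kappa>: "\<kappa> > 0" using T by (simp add: \<kappa>_def)
  define \<rho> where "\<rho> = \<kappa> * \<delta>"
  have \<rho>: "\<rho> > 0" using \<kappa> \<delta> by (simp add: \<rho>_def)
  have a0: "a > 0" and C0: "C > 0" using K by (auto simp: a C)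
  note post = posterior_in_algorithms[OF P, of m' \<sigma>]
  obtain \<nu> where \<nu>: "\<nu> \<in> space (prob_algebra ?V)"
    and heavy: "emeasure R {u \<in> space ?V. emeasure \<nu> (l2_ball n u (K * \<sigma>)) < ennreal \<kappa>} \<le> ennreal (2 * \<delta>)"
    using algorithm_reference_output[OF m \<sigma> \<delta> R ball A S succ] unfolding \<kappa>_def T_def by blast
  define I where "I = {u \<in> space ?V. emeasure P (l2_ball n u (a * \<sigma>)) < ennreal \<rho>}"
  have "2 * (K * \<sigma>) + 3 * \<sigma> = a * \<sigma>" by (simp add: a algebra_simps)
  then have RI: "emeasure R I \<le> ennreal (4 * \<delta>)"
    using emeasure_isolated_signals_le[OF R P \<nu> \<gamma> close \<kappa> \<delta> heavy] by (simp add: I_def \<rho>_def)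
  have sR[measurable_cong]: "sets R = sets ?V" using R by (simp add: space_prob_algebra)
  interpret R: prob_space R using R by (simp add: space_prob_algebra)
  have I[measurable]: "I \<in> sets R"
    using measurable_emeasure_l2_ball[OF P, measurable] unfolding I_def sR by measurable
  have Gprob: "prob_space (gaussian_matrix m' n)" and Nprob: "prob_space (noise m' \<sigma>)"
    using gaussian_matrix_in_prob_algebra[OF m'(1), of n] noise_in_prob_algebra[OF m'(1) \<sigma>]
    by (auto simp: space_prob_algebra)
  let ?F = "\<lambda>u. \<integral>\<^sup>+\<xi>. (\<integral>\<^sup>+A. emeasure (posterior m' n \<sigma> P (vec_add m' (mat_vec m' n A u) \<xi>, A))
      {x \<in> space ?V. \<not> l2_dist n u x \<le> C * \<sigma>} \<partial>gaussian_matrix m' n) \<partial>noise m' \<sigma>"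
  have F1: "?F u \<le> 1" for u
  proof -
    have "?F u \<le> (\<integral>\<^sup>+\<xi>. (\<integral>\<^sup>+A. 1 \<partial>gaussian_matrix m' n) \<partial>noise m' \<sigma>)"
    proof (intro nn_integral_mono)
      fix \<xi> A assume "A \<in> space (gaussian_matrix m' n)"
      then have "A \<in> space (mat_space m' n)"
        using gaussian_matrix_in_prob_algebra[OF m'(1), of n]
        by (auto simp: space_prob_algebra dest: sets_eq_imp_space_eq)
      then have "posterior m' n \<sigma> P (vec_add m' (mat_vec m' n A u) \<xi>, A) \<in> space (prob_algebra ?V)"
        by (rule algorithm_in_prob_algebra[OF post vec_add_in_space])
      then show "emeasure (posterior m' n \<sigma> P (vec_add m' (mat_vec m' n A u) \<xi>, A))
          {x \<in> space ?V. \<not> l2_dist n u x \<le> C * \<sigma>} \<le> 1"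
        by (simp add: space_prob_algebra prob_space.emeasure_le_1)
    qed
    also have "\<dots> = 1" by (simp add: prob_space.emeasure_space_1[OF Gprob] prob_space.emeasure_space_1[OF Nprob])
    finally show ?thesis .
  qed
  have F2: "?F u \<le> ennreal (4 * \<delta>)" if u: "u \<in> space ?V" "u \<notin> I" for u
  proof -
    have "emeasure P {x \<in> space ?V. l2_dist n u x \<le> a * \<sigma>} \<ge> ennreal \<rho>"
      using u by (auto simp: I_def l2_ball_def)
    \<comment> \<open>The threshold \<open>b * m'\<close> is eight times
      \<open>m' * (1 + a\<^sup>2) / 2\<close>, an upper bound for the mean misfit of candidates
      within \<open>a * \<sigma>\<close> of \<open>u\<close>.\<close>
    from posterior_failure_le[OF m'(1) \<sigma> P u(1) \<rho> this a0 C0 refl, of "b * real m'"]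
    show ?thesis
    proof (rule order_trans, intro ennreal_leI)
      have "(1 + T) ^ (2 * m) = exp (2 * (real m * ln (1 + T)))"
      proof -
        have "exp (2 * (real m * ln (1 + T))) = exp (real (2 * m) * ln (1 + T))" by (simp add: mult.assoc)
        also have "\<dots> = (1 + T) ^ (2 * m)" using T by (subst exp_of_nat_mult) simp
        finally show ?thesis by simp
      qed
      then have "\<rho> = \<delta> / (4 * exp (2 * (real m * ln (1 + T))))" by (simp add: \<rho>_def \<kappa>_def)
      then show "2 * exp (- (1 / (2 * (1 + a\<^sup>2))) * (b * real m')) * sqrt 2 ^ m' +
          2 / \<rho> * exp (b * real m') * (1 / sqrt (2 + C\<^sup>2)) ^ m' \<le> 4 * \<delta>"
        using T m'(2)
        by (intro numeric_failure_bound[OF b C \<delta> True, where L="real m * ln (1 + T)"]) (auto simp: T_def)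
    qed
  qed
  define L where "L = gaussian_recovery_law m' n \<sigma> R (posterior m' n \<sigma> P)"
  have L: "L \<in> space (prob_algebra (?V \<Otimes>\<^sub>M ?V))"
    using prob_space_bind'[OF gaussian_matrix_in_prob_algebra[OF m'(1)] recovery_law_measurable[OF m'(1) \<sigma> R post]]
      sets_bind'[OF gaussian_matrix_in_prob_algebra[OF m'(1)] recovery_law_measurable[OF m'(1) \<sigma> R post]]
    by (simp add: L_def gaussian_recovery_law_def space_prob_algebra)
  have "ennreal (1 - \<P>((x, xh) in L. l2_dist n x xh \<le> C * \<sigma>)) = (\<integral>\<^sup>+u. ?F u \<partial>R)"
    by (subst prob_Compl_event[OF L, symmetric])
       (measurable, simp add: L_def emeasure_gaussian_recovery_failure[OF m'(1) \<sigma> R post])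
  also have "\<dots> \<le> (\<integral>\<^sup>+u. indicator I u + ennreal (4 * \<delta>) \<partial>R)"
  proof (rule nn_integral_mono)
    fix u assume "u \<in> space R"
    then show "?F u \<le> indicator I u + ennreal (4 * \<delta>)"
      using F1[of u] F2[of u] sets_eq_imp_space_eq[OF sR] by (cases "u \<in> I") (auto intro: order_trans)
  qed
  also have "\<dots> = emeasure R I + ennreal (4 * \<delta>)"
    by (simp add: nn_integral_add R.emeasure_space_1)
  also have "\<dots> \<le> ennreal (4 * \<delta>) + ennreal (4 * \<delta>)"
    by (intro add_right_mono RI)
  also have "\<dots> = ennreal (8 * \<delta>)"
    using \<delta> by (simp add: ennreal_plus[symmetric] del: ennreal_plus)
  finally show ?thesis
    using \<delta> by (simp add: L_def)
qed

theorem theorem1p1: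
  fixes K :: real
  assumes "K > 0"
  shows "\<exists>C1>0. \<exists>C2>0. \<exists>C3>0. \<exists>c>0.
    \<forall>(n::nat) (m::nat) (r::real) (\<sigma>::real) (\<delta>::real) (R :: rvec measure) (A :: rmat).
      n \<ge> 1 \<and> m \<ge> 1 \<and> r > 0 \<and> \<sigma> > 0 \<and> 0 < \<delta> \<and> \<delta> < 1 \<and>
      R \<in> space (prob_algebra (vec_space n)) \<and> supported_on_ball n r R \<and>
      A \<in> space (mat_space m n) \<and>
      (\<exists>S\<in>algorithms m n.
         \<P>((x, xh) in recovery_law m n \<sigma> R A S. l2_dist n x xh \<le> K * \<sigma>) \<ge> 1 - \<delta>) \<longrightarrow>
      (\<forall>m'::nat. m' \<ge> 1 \<and>
         real m' \<ge> C1 * (real m * ln (1 + real m * r\<^sup>2 * (mat_norm_inf m n A)\<^sup>2 / \<sigma>\<^sup>2) + ln (1 / \<delta>)) \<longrightarrow>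
         \<P>((x, xh) in gaussian_recovery_law m' n \<sigma> R (posterior m' n \<sigma> R).
             l2_dist n x xh \<le> C2 * \<sigma>) \<ge> 1 - C3 * \<delta> \<and>
         (\<forall>P\<in>space (prob_algebra (vec_space n)).
            (\<exists>p\<ge>1. wasserstein n p R P \<le> ennreal (c * \<sigma> * \<delta> powr (1 / p))) \<longrightarrow>
            \<P>((x, xh) in gaussian_recovery_law m' n \<sigma> R (posterior m' n \<sigma> P).
                l2_dist n x xh \<le> C2 * \<sigma>) \<ge> 1 - C3 * \<delta>))"
proof -
  define a where "a = 2 * K + 3"
  define b where "b = 4 * (1 + a\<^sup>2)"
  define C where "C = exp (b + 2)"
  have C0: "C > 0" by (simp add: C_def)
  show ?thesis
  \<comment> \<open>The witnesses are \<open>C1 = 2\<close>, \<open>C2 = C\<close>,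
    \<open>C3 = 8\<close> and \<open>c = 1 / 2\<close>; \<open>K\<close> enters through
    \<open>C\<close> alone.\<close>
  proof (rule exI[of _ 2], rule conjI[OF zero_less_numeral], rule exI[of _ C], rule conjI[OF C0],
      rule exI[of _ 8], rule conjI[OF zero_less_numeral], rule exI[of _ "1 / 2"], rule conjI[OF half_gt_zero[OF zero_less_one]],
      intro allI impI conjI ballI; (elim conjE bexE exE)?)
    fix n m :: nat and r \<sigma> \<delta> :: real and R :: "rvec measure" and A :: rmat and m' :: nat and S
    assume "m \<ge> 1" "\<sigma> > 0" "0 < \<delta>" "R \<in> space (prob_algebra (vec_space n))" "supported_on_ball n r R"
      "A \<in> space (mat_space m n)" "S \<in> algorithms m n"
      "\<P>((x, xh) in recovery_law m n \<sigma> R A S. l2_dist n x xh \<le> K * \<sigma>) \<ge> 1 - \<delta>"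
      "m' \<ge> 1"
      "real m' \<ge> 2 * (real m * ln (1 + real m * r\<^sup>2 * (mat_norm_inf m n A)\<^sup>2 / \<sigma>\<^sup>2) + ln (1 / \<delta>))"
    note * = posterior_sampling_success[OF assms a_def b_def C_def this]
    obtain \<gamma> where "\<gamma> \<in> couplings n R R" "emeasure \<gamma> {q \<in> space \<gamma>. \<sigma> < l2_dist n (fst q) (snd q)} = 0"
      using diagonal_coupling \<open>R \<in> _\<close> \<open>\<sigma> > 0\<close> by blast
    then show "\<P>((x, xh) in gaussian_recovery_law m' n \<sigma> R (posterior m' n \<sigma> R). l2_dist n x xh \<le> C * \<sigma>) \<ge> 1 - 8 * \<delta>"
      by (intro *[OF \<open>R \<in> _\<close>]) auto
    fix P p
    assume P: "P \<in> space (prob_algebra (vec_space n))" and "p \<ge> 1"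
      "wasserstein n p R P \<le> ennreal (1 / 2 * \<sigma> * \<delta> powr (1 / p))"
    then obtain \<gamma> where "\<gamma> \<in> couplings n R P"
      "emeasure \<gamma> {q \<in> space \<gamma>. \<sigma> < l2_dist n (fst q) (snd q)} \<le> ennreal \<delta>"
      using coupling_of_wasserstein \<open>\<sigma> > 0\<close> \<open>0 < \<delta>\<close> by blast
    then show "\<P>((x, xh) in gaussian_recovery_law m' n \<sigma> R (posterior m' n \<sigma> P). l2_dist n x xh \<le> C * \<sigma>) \<ge> 1 - 8 * \<delta>"
      by (rule *[OF P])
  qed
qed

end
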